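(* Let $L>0$, $T>0$ and let $w\in W^{1,\infty}(0,T)$ be a function satisfying $w(0)=0$. Then for all $s\in(0,1)$ there is a constant $C=C(s)>0$ such that for all $\varepsilon>0$ there exists a control $v_\varepsilon$ satisfying $$\|v_\varepsilon\|_{C^0([0,T])}\leq C\exp\left[C\left(\frac{\|w\|_{W^{1,\infty}(0,T)}}{\varepsilon}\right)^{1/s}\right]\|w\|_{W^{1,\infty}(0,T)},$$ and such that the solution $y$ of $$\begin{cases} y_t-\partial_{xx}y=0 & \text{in } (0,T)\times(0,L),\\ y(\cdot,0)=0 & \text{on } (0,T),\\ y(\cdot,L)=v_\varepsilon & \text{on } (0,T),\\ y(0,\cdot)=0 & \text{in } (0,L),\end{cases}$$ satisfies $$\|\partial_x y(\cdot,0)-w\|_{C^0([0,T])}\leq\varepsilon.$$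
   Context: Functions $y=y(t,x)$ have the time variable $t\in(0,T)$ first and the space variable $x\in(0,L)$ second; so $y(\cdot,0)$, $y(\cdot,L)$ and $\partial_xy(\cdot,0)$ denote boundary traces, at $x=0$ or $x=L$, as functions of time. Functions in $W^{1,\infty}(0,T)$ are identified with their continuous representatives on $[0,T]$. *)

theory Defs
  imports "HOL-Analysis.Analysis" "HOL-Probability.Essential_Supremum"
begin

definition Linf :: "real \<Rightarrow> (real \<Rightarrow> real) \<Rightarrow> bool" where
  "Linf T f \<longleftrightarrow> f \<in> borel_measurable (lebesgue_on {0<..<T}) \<and>
     esssup (lebesgue_on {0<..<T}) (\<lambda>t. ereal \<bar>f t\<bar>) < \<infinity>"

definition Linf_norm :: "real \<Rightarrow> (real \<Rightarrow> real) \<Rightarrow> real" where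
  "Linf_norm T f = real_of_ereal (esssup (lebesgue_on {0<..<T}) (\<lambda>t. ereal \<bar>f t\<bar>))"

definition test_function :: "real \<Rightarrow> (real \<Rightarrow> real) \<Rightarrow> bool" where
  "test_function T \<phi> \<longleftrightarrow> (\<forall>n x. (deriv ^^ n) \<phi> differentiable (at x)) \<and>
     compact (closure {x. \<phi> x \<noteq> 0}) \<and> closure {x. \<phi> x \<noteq> 0} \<subseteq> {0<..<T}"

definition has_weak_deriv :: "real \<Rightarrow> (real \<Rightarrow> real) \<Rightarrow> (real \<Rightarrow> real) \<Rightarrow> bool" where
  "has_weak_deriv T w g \<longleftrightarrow> (\<forall>\<phi>. test_function T \<phi> \<longrightarrow>
     (\<integral>t. w t * deriv \<phi> t \<partial>lebesgue_on {0<..<T}) = - (\<integral>t. g t * \<phi> t \<partial>lebesgue_on {0<..<T}))"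

text \<open>Elements of \<open>W\<^sup>1\<^sup>,\<^sup>\<infinity>(0,T)\<close> are represented by their continuous representatives
  on \<open>[0,T]\<close>; the values of \<open>w\<close> outside \<open>[0,T]\<close> play no role.\<close>

definition W1inf :: "real \<Rightarrow> (real \<Rightarrow> real) \<Rightarrow> bool" where
  "W1inf T w \<longleftrightarrow> continuous_on {0..T} w \<and> Linf T w \<and> (\<exists>g. Linf T g \<and> has_weak_deriv T w g)"

text \<open>The weak derivative is unique almost everywhere, so the choice does not
  affect the norm below.\<close>

definition weak_deriv :: "real \<Rightarrow> (real \<Rightarrow> real) \<Rightarrow> real \<Rightarrow> real" where
  "weak_deriv T w = (SOME g. Linf T g \<and> has_weak_deriv T w g)"

definition W1inf_norm :: "real \<Rightarrow> (real \<Rightarrow> real) \<Rightarrow> real" where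
  "W1inf_norm T w = Linf_norm T w + Linf_norm T (weak_deriv T w)"

definition C0_norm :: "real \<Rightarrow> (real \<Rightarrow> real) \<Rightarrow> real" where
  "C0_norm T f = (SUP t\<in>{0..T}. \<bar>f t\<bar>)"

text \<open>Classical solutions, in \<open>C([0,T] \<times> [0,L])\<close> and \<open>C\<^sup>1\<^sup>,\<^sup>2((0,T) \<times> (0,L))\<close>. By the maximum
  principle there is at most one on \<open>[0,T] \<times> [0,L]\<close>; continuity up to the corners forces
  \<open>v 0 = 0\<close>.\<close>

definition heat_solution :: "real \<Rightarrow> real \<Rightarrow> (real \<Rightarrow> real) \<Rightarrow> (real \<Rightarrow> real \<Rightarrow> real) \<Rightarrow> bool" where
  "heat_solution L T v y \<longleftrightarrow>
     continuous_on ({0..T} \<times> {0..L}) (\<lambda>(t, x). y t x) \<and>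
     (\<forall>t\<in>{0<..<T}. \<forall>x\<in>{0<..<L}.
        (\<lambda>\<tau>. y \<tau> x) differentiable (at t) \<and>
        y t differentiable (at x) \<and>
        deriv (y t) differentiable (at x)) \<and>
     continuous_on ({0<..<T} \<times> {0<..<L}) (\<lambda>(t, x). deriv (\<lambda>\<tau>. y \<tau> x) t) \<and>
     continuous_on ({0<..<T} \<times> {0<..<L}) (\<lambda>(t, x). deriv (y t) x) \<and>
     continuous_on ({0<..<T} \<times> {0<..<L}) (\<lambda>(t, x). deriv (deriv (y t)) x) \<and>
     (\<forall>t\<in>{0<..<T}. \<forall>x\<in>{0<..<L}. deriv (\<lambda>\<tau>. y \<tau> x) t - deriv (deriv (y t)) x = 0) \<and>
     (\<forall>t\<in>{0<..<T}. y t 0 = 0) \<and>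
     (\<forall>t\<in>{0<..<T}. y t L = v t) \<and>
     (\<forall>x\<in>{0<..<L}. y 0 x = 0)"

text \<open>\<open>p\<close> is the trace of the space derivative of \<open>y\<close> at \<open>x = 0\<close>, as an element
  of \<open>C\<^sup>0([0,T])\<close>; it is determined on \<open>[0,T]\<close> by \<open>y\<close>.\<close>

definition dx_trace_left :: "real \<Rightarrow> real \<Rightarrow> (real \<Rightarrow> real \<Rightarrow> real) \<Rightarrow> (real \<Rightarrow> real) \<Rightarrow> bool" where
  "dx_trace_left L T y p \<longleftrightarrow> continuous_on {0..T} p \<and>
     (\<forall>t\<in>{0..T}. (y t has_real_derivative p t) (at 0 within {0..L}))"

end

(*
Averaging w over windows of lengths a_0, a_1, ... with sum delta gives a function W_0 within
delta * Lip(w) of w; the averages are one-sided, so W_0 vanishes for t <= 0. Writing W_k for the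
result of the averages from the k-th on, the derivative of an average is a difference quotient,
whence the k-th derivative of W_0 is the iterated difference quotient of W_k with steps
a_0, ..., a_(k-1), and is bounded by sup |w| * prod_(j<k) (2 / a_j). With a_j proportional to
delta * (j+1)^(s-2) this is the Gevrey estimate of order 2 - s. Hence the flatness series
y(t,x) = sum_k W_0^(k)(t) x^(2k+1) / (2k+1)! converges, solves the heat equation with
dy/dx(t,0) = W_0(t), and the choice delta = epsilon / ||w|| gives the cost estimate at x = L.

Smoothing a ramp by the same averages gives the test functions which show that the Lipschitz
constant of w is at most the sup norm of its weak derivative.
*)
theory Submission
  imports Defs
begin

section \<open>Smoothing by iterated one-sided averages\<close>

text \<open>The two ends of the range of s enter at different places. The windows (j+1)^(s-2) have a
  finite sum because s < 1. Dividing derivative bounds of size (k!)^(2-s) by (2k+1)! >= (k!)^2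
  leaves (k!)^(-s), so the flatness series converges for every x because s > 0. The sum of X^k /
  (k!)^s is at most a constant times exp (c X^(1/s)), with X proportional to 1/delta: this is the
  origin of the exponent 1/s in the cost. Averages with explicit windows stand in for convolution
  with a Gevrey kernel, and every bound becomes a product of factors 2 / a_j. One-sidedness keeps
  all time derivatives zero at t = 0, which is the initial condition; w(0) = 0 lets w be continued
  by 0 to t < 0 with the same Lipschitz constant. Two obstacles lie outside the construction. The
  norm of w speaks of an essential supremum of a weak derivative, whereas the smoothing error needs
  a Lipschitz constant. And the trace estimate is demanded of every solution with the given control,
  so uniqueness, by a maximum principle, has to carry it over from the series.\<close>

definition avg :: "real \<Rightarrow> (real \<Rightarrow> real) \<Rightarrow> real \<Rightarrow> real" where
  "avg h f t = integral {0..1} (\<lambda>r. f (t - h * r))"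

lemma avg_const [simp]: "avg h (\<lambda>_. c) t = c"
  by (simp add: avg_def)

lemma integrable_avg:
  fixes f :: "real \<Rightarrow> real"
  assumes "continuous_on UNIV f"
  shows "(\<lambda>r. f (t - h * r)) integrable_on {0..1::real}"
proof (rule integrable_continuous_real)
  show "continuous_on {0..1} (\<lambda>r. f (t - h * r))"
    by (rule continuous_on_compose2[OF assms]) (auto intro!: continuous_intros)
qed

lemma avg_mono:
  assumes "continuous_on UNIV f" "continuous_on UNIV g"
    and "\<And>r. r \<in> {0..1} \<Longrightarrow> f (t - h * r) \<le> g (t' - h * r)"
  shows "avg h f t \<le> avg h g t'"
  unfolding avg_def by (intro integral_le integrable_avg assms)

text \<open>Allowing two functions and two base points at once lets one estimate serve for moduli of
  continuity (same function, shifted point) and for errors (two functions, same point). Since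
  \<open>avg\<close> rescales its window to [0,1], only integrands need comparing.\<close>

lemma avg_diff_le:
  assumes "continuous_on UNIV f" "continuous_on UNIV g"
    and "\<And>r. r \<in> {0..1} \<Longrightarrow> \<bar>f (t - h * r) - g (t' - h * r)\<bar> \<le> e"
  shows "\<bar>avg h f t - avg h g t'\<bar> \<le> e"
proof -
  have "avg h f t - avg h g t' = integral {0..1} (\<lambda>r. f (t - h * r) - g (t' - h * r))"
    unfolding avg_def by (intro integral_diff[symmetric] integrable_avg assms)
  also have "norm \<dots> \<le> integral {0..1} (\<lambda>r::real. e)"
    using assms(3) by (intro integral_norm_bound_integral integrable_diff integrable_avg assms) auto
  finally show ?thesis by simp
qed

lemma avg_lipschitz:
  assumes "G-lipschitz_on UNIV f"
  shows "G-lipschitz_on UNIV (avg h f)"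
proof (rule lipschitz_onI)
  show "0 \<le> G" using assms by (rule lipschitz_on_nonneg)
  fix x y
  show "dist (avg h f x) (avg h f y) \<le> G * dist x y"
    unfolding dist_real_def
  proof (intro avg_diff_le lipschitz_on_continuous_on[OF assms])
    fix r
    show "\<bar>f (x - h * r) - f (y - h * r)\<bar> \<le> G * \<bar>x - y\<bar>"
      using lipschitz_onD[OF assms, of "x - h * r" "y - h * r"] by (simp add: dist_real_def)
  qed
qed

lemma avg_close:
  assumes "G-lipschitz_on UNIV f" "h \<ge> 0"
  shows "\<bar>avg h f t - f t\<bar> \<le> G * h"
proof -
  have "\<bar>avg h f t - avg h (\<lambda>_. f t) t\<bar> \<le> G * h"
  proof (intro avg_diff_le lipschitz_on_continuous_on[OF assms(1)] continuous_intros)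
    fix r :: real assume r: "r \<in> {0..1}"
    have "\<bar>f (t - h * r) - f t\<bar> \<le> G * (h * r)"
      using lipschitz_onD[OF assms(1), of "t - h * r" t] assms(2) r by (simp add: dist_real_def)
    also have "\<dots> \<le> G * h"
      using lipschitz_on_nonneg[OF assms(1)] assms(2) r
      by (intro mult_left_mono) (auto intro: mult_left_le)
    finally show "\<bar>f (t - h * r) - f t\<bar> \<le> G * h" .
  qed
  then show ?thesis by simp
qed

definition bdiff :: "real \<Rightarrow> (real \<Rightarrow> real) \<Rightarrow> real \<Rightarrow> real" where
  "bdiff h f t = (f t - f (t - h)) / h"

text \<open>Averaging gains one derivative from mere continuity: with an antiderivative P of f on
  the whole line, the average is the difference quotient (P x - P (x - h)) / h.\<close>

lemma avg_has_derivative: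
  assumes "continuous_on UNIV f" "h > 0"
  shows "(avg h f has_real_derivative bdiff h f t) (at t)"
proof -
  obtain P where P: "\<And>x. (P has_real_derivative f x) (at x)"
    using einterval_antiderivative[of "-\<infinity>" "\<infinity>" f] assms(1)
    by (auto simp: continuous_on_eq_continuous_at has_real_derivative_iff_has_vector_derivative)
  have eq: "avg h f x = (P x - P (x - h)) / h" for x
  proof -
    have "((\<lambda>r. f (x - h * r)) has_integral (- P (x - h * 1) / h) - (- P (x - h * 0) / h)) {0..1}"
    proof (rule fundamental_theorem_of_calculus, goal_cases)
      case (2 r)
      have "((\<lambda>r. - P (x - h * r) * inverse h) has_real_derivative - (f (x - h * r) * (- h)) * inverse h) (at r)"
        by (intro DERIV_cmult_right DERIV_minus DERIV_chain2[where f=P, OF P]) (auto intro!: derivative_eq_intros)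
      moreover have "- (f (x - h * r) * (- h)) * inverse h = f (x - h * r)"
        using assms(2) by (simp add: field_simps)
      ultimately have "((\<lambda>r. - P (x - h * r) * inverse h) has_real_derivative f (x - h * r)) (at r)"
        by (simp only:)
      then show ?case
        by (simp add: divide_inverse has_real_derivative_iff_has_vector_derivative[symmetric]
            has_field_derivative_at_within)
    qed simp
    then show ?thesis unfolding avg_def
      by (simp add: integral_unique diff_divide_distrib)
  qed
  have "((\<lambda>x. (P x - P (x - h)) / h) has_real_derivative (f t - f (t - h)) / h) (at t)"
    using assms(2) by (auto intro!: derivative_eq_intros P DERIV_chain2[where f=P] )
  then show ?thesis by (simp add: eq[abs_def] bdiff_def)
qed

text \<open>n counts the averages and k is the index of the outermost window, so the windows from
  outside in are a k, ..., a (k + n - 1). Keeping k as a parameter makes the limit over n a family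
  in k, each member being an average of the next.\<close>

fun iterated_avg :: "(nat \<Rightarrow> real) \<Rightarrow> (real \<Rightarrow> real) \<Rightarrow> nat \<Rightarrow> nat \<Rightarrow> real \<Rightarrow> real" where
  "iterated_avg a f 0 k = f"
| "iterated_avg a f (Suc n) k = avg (a k) (iterated_avg a f n (Suc k))"

definition smoothing :: "(nat \<Rightarrow> real) \<Rightarrow> (real \<Rightarrow> real) \<Rightarrow> nat \<Rightarrow> real \<Rightarrow> real" where
  "smoothing a f k t = lim (\<lambda>n. iterated_avg a f n k t)"

text \<open>The total width of the windows from the k-th on: \<open>smoothing a f k\<close> at time
  t depends on f only through its values on [t - \<open>tail_sum a k\<close>, t].\<close>

definition tail_sum :: "(nat \<Rightarrow> real) \<Rightarrow> nat \<Rightarrow> real" where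
  "tail_sum a k = (\<Sum>j. a (j + k))"

locale smoothing_setup =
  fixes a :: "nat \<Rightarrow> real" and f :: "real \<Rightarrow> real" and G :: real
  assumes a_pos: "a k > 0" and a_summable: "summable a" and lip: "G-lipschitz_on UNIV f"
begin

lemma tail_sum_split: "tail_sum a k = a k + tail_sum a (Suc k)"
  using suminf_split_head[of "\<lambda>j. a (j + k)"] a_summable
  by (simp add: tail_sum_def summable_iff_shift)

lemma tail_sum_nonneg: "tail_sum a k \<ge> 0"
  unfolding tail_sum_def using a_pos a_summable
  by (intro suminf_nonneg) (auto simp: summable_iff_shift less_imp_le)

lemma tail_sum_tendsto: "tail_sum a \<longlonglongrightarrow> 0"
  unfolding tail_sum_def using suminf_exist_split2[OF a_summable] .

lemma iterated_avg_lipschitz: "G-lipschitz_on UNIV (iterated_avg a f n k)"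
  by (induction n arbitrary: k) (auto intro: lip avg_lipschitz)

lemmas iterated_avg_continuous = lipschitz_on_continuous_on[OF iterated_avg_lipschitz]

text \<open>The extra average sits innermost, directly on f, where it moves values by at most G
  times its window; the averages outside it do not increase uniform distances.\<close>

lemma iterated_avg_step: "\<bar>iterated_avg a f (Suc n) k t - iterated_avg a f n k t\<bar> \<le> G * a (k + n)"
proof (induction n arbitrary: k t)
  case 0
  then show ?case using avg_close[OF lip] a_pos by (simp add: less_imp_le)
next
  case (Suc n)
  show ?case
    unfolding iterated_avg.simps(2)[of _ _ "Suc n"] iterated_avg.simps(2)[of _ _ n k]
    using Suc.IH[of "Suc k"] by (intro avg_diff_le iterated_avg_continuous) simp
qed

text \<open>Averaging preserves two-sided bounds and each window only looks back, so bounds are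
  needed only on the stretch of the past covered by all windows. In the limit, suitable lo and hi
  give vanishing at early times, the sup bound and closeness to f.\<close>

lemma iterated_avg_bounds:
  assumes "\<And>x. t - tail_sum a k \<le> x \<Longrightarrow> x \<le> t \<Longrightarrow> lo \<le> f x \<and> f x \<le> hi"
  shows "lo \<le> iterated_avg a f n k t \<and> iterated_avg a f n k t \<le> hi"
  using assms
proof (induction n arbitrary: k t)
  case 0
  then show ?case using tail_sum_nonneg[of k] by auto
next
  case (Suc n)
  have *: "lo \<le> iterated_avg a f n (Suc k) (t - a k * r)
      \<and> iterated_avg a f n (Suc k) (t - a k * r) \<le> hi" if r: "r \<in> {0..1}" for r
  proof (rule Suc.IH)
    fix x assume x: "t - a k * r - tail_sum a (Suc k) \<le> x" "x \<le> t - a k * r"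
    have "a k * r \<le> a k" "a k * r \<ge> 0" using r a_pos[of k] by (auto intro: mult_left_le less_imp_le)
    then show "lo \<le> f x \<and> f x \<le> hi"
      using Suc.prems[of x] x tail_sum_split[of k] by auto
  qed
  have "avg (a k) (\<lambda>_. lo) t \<le> avg (a k) (iterated_avg a f n (Suc k)) t"
    using * by (intro avg_mono iterated_avg_continuous continuous_intros) auto
  moreover have "avg (a k) (iterated_avg a f n (Suc k)) t \<le> avg (a k) (\<lambda>_. hi) t"
    using * by (intro avg_mono iterated_avg_continuous continuous_intros) auto
  ultimately show ?case by simp
qed

lemma iterated_avg_mono:
  assumes "mono f"
  shows "mono (iterated_avg a f n k)"
proof (induction n arbitrary: k)
  case (Suc n)
  show ?case
    by (auto intro!: monoI avg_mono iterated_avg_continuous monoD[OF Suc.IH])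
qed (simp add: assms)

text \<open>Telescoping: the successive differences are dominated by the summable G * a (k + n), and
  the tail of the dominating series is the error. The error is uniform in t, as needed for a limit
  under an integral.\<close>

lemma iterated_avg_limit:
  shows iterated_avg_tendsto: "(\<lambda>n. iterated_avg a f n k t) \<longlonglongrightarrow> smoothing a f k t"
    and iterated_avg_error: "\<bar>smoothing a f k t - iterated_avg a f n k t\<bar> \<le> G * tail_sum a (n + k)"
proof -
  let ?d = "\<lambda>n. iterated_avg a f (Suc n) k t - iterated_avg a f n k t"
  have sa: "summable (\<lambda>n. G * a (k + n))"
    using a_summable by (intro summable_mult) (simp add: summable_iff_shift add.commute)
  have d: "norm (?d n) \<le> G * a (k + n)" for n
    using iterated_avg_step[of n k t] by simp
  have sd: "summable ?d" by (rule summable_comparison_test[OF _ sa]) (use d in blast)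
  have "?d sums (\<Sum>n. ?d n)" using sd by (rule summable_sums)
  then have "(\<lambda>n. iterated_avg a f n k t - iterated_avg a f 0 k t) \<longlonglongrightarrow> (\<Sum>n. ?d n)"
    by (simp only: sums_def sum_lessThan_telescope[of "\<lambda>n. iterated_avg a f n k t"])
  then have "(\<lambda>n. iterated_avg a f n k t - iterated_avg a f 0 k t + iterated_avg a f 0 k t)
      \<longlonglongrightarrow> (\<Sum>n. ?d n) + iterated_avg a f 0 k t"
    by (intro tendsto_intros)
  then have "convergent (\<lambda>n. iterated_avg a f n k t)" by (auto simp: convergent_def)
  then show lim: "(\<lambda>n. iterated_avg a f n k t) \<longlonglongrightarrow> smoothing a f k t"
    unfolding smoothing_def by (simp add: convergent_LIMSEQ_iff)
  have "(\<lambda>m. iterated_avg a f (m + n) k t) \<longlonglongrightarrow> smoothing a f k t"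
    using lim by (rule LIMSEQ_ignore_initial_segment)
  then have "(\<lambda>m. (\<Sum>i<m. ?d (i + n))) \<longlonglongrightarrow> smoothing a f k t - iterated_avg a f n k t"
    using sum_lessThan_telescope[of "\<lambda>m. iterated_avg a f (m + n) k t"]
    by (simp add: tendsto_diff)
  then have eq: "(\<Sum>i. ?d (i + n)) = smoothing a f k t - iterated_avg a f n k t"
    by (simp add: sums_def[symmetric] sums_iff)
  have sa': "summable (\<lambda>i. G * a (k + (i + n)))"
    using sa by (rule summable_ignore_initial_segment)
  have "norm (\<Sum>i. ?d (i + n)) \<le> (\<Sum>i. G * a (k + (i + n)))"
    by (rule norm_suminf_le[OF d sa'])
  also have "\<dots> = G * tail_sum a (n + k)"
    unfolding tail_sum_def using a_summable
    by (subst suminf_mult[symmetric]) (simp_all add: summable_iff_shift ac_simps)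
  finally show "\<bar>smoothing a f k t - iterated_avg a f n k t\<bar> \<le> G * tail_sum a (n + k)"
    unfolding eq by simp
qed

lemma smoothing_lipschitz: "G-lipschitz_on UNIV (smoothing a f k)"
proof (rule lipschitz_onI)
  show "0 \<le> G" using lip by (rule lipschitz_on_nonneg)
  fix x y
  have "(\<lambda>n. dist (iterated_avg a f n k x) (iterated_avg a f n k y))
      \<longlonglongrightarrow> dist (smoothing a f k x) (smoothing a f k y)"
    by (intro tendsto_dist iterated_avg_tendsto)
  then show "dist (smoothing a f k x) (smoothing a f k y) \<le> G * dist x y"
    by (rule LIMSEQ_le_const2) (use lipschitz_onD[OF iterated_avg_lipschitz] in auto)
qed

lemmas smoothing_continuous = lipschitz_on_continuous_on[OF smoothing_lipschitz]

lemma smoothing_bounds: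
  assumes "\<And>x. t - tail_sum a k \<le> x \<Longrightarrow> x \<le> t \<Longrightarrow> lo \<le> f x \<and> f x \<le> hi"
  shows "lo \<le> smoothing a f k t \<and> smoothing a f k t \<le> hi"
  using iterated_avg_bounds[OF assms]
  by (intro conjI LIMSEQ_le_const[OF iterated_avg_tendsto] LIMSEQ_le_const2[OF iterated_avg_tendsto]) auto

lemma smoothing_mono: "mono f \<Longrightarrow> mono (smoothing a f k)"
  by (rule monoI, rule LIMSEQ_le[OF iterated_avg_tendsto iterated_avg_tendsto])
    (use monoD[OF iterated_avg_mono] in blast)

text \<open>The recursion for finitely many averages survives the limit, because the uniform error
  bound passes through \<open>avg\<close>. It exhibits the limit as an average of a function of the
  same kind, which can therefore be differentiated again and again.\<close>

lemma smoothing_unfold: "smoothing a f k = avg (a k) (smoothing a f (Suc k))"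
proof
  fix t
  have "\<bar>avg (a k) (iterated_avg a f n (Suc k)) t - avg (a k) (smoothing a f (Suc k)) t\<bar>
      \<le> G * tail_sum a (n + Suc k)" for n
    using iterated_avg_error[of "Suc k" _ n]
    by (intro avg_diff_le iterated_avg_continuous smoothing_continuous) (simp add: abs_minus_commute)
  then have bd: "norm (iterated_avg a f (Suc n) k t - avg (a k) (smoothing a f (Suc k)) t)
      \<le> G * tail_sum a (n + Suc k)" for n
    by simp
  have "(\<lambda>n. G * tail_sum a (n + Suc k)) \<longlonglongrightarrow> 0"
    using tendsto_mult_right_zero[OF LIMSEQ_ignore_initial_segment[OF tail_sum_tendsto]] .
  then have "(\<lambda>n. iterated_avg a f (Suc n) k t - avg (a k) (smoothing a f (Suc k)) t) \<longlonglongrightarrow> 0"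
    by (rule Lim_null_comparison[rotated]) (intro always_eventually allI bd)
  then have "(\<lambda>n. iterated_avg a f (Suc n) k t) \<longlonglongrightarrow> avg (a k) (smoothing a f (Suc k)) t"
    by (simp only: LIM_zero_iff)
  moreover have "(\<lambda>n. iterated_avg a f (Suc n) k t) \<longlonglongrightarrow> smoothing a f k t"
    using iterated_avg_tendsto by (rule LIMSEQ_Suc)
  ultimately show "smoothing a f k t = avg (a k) (smoothing a f (Suc k)) t"
    by (rule LIMSEQ_unique[symmetric])
qed

lemma smoothing_has_derivative:
  "(smoothing a f k has_real_derivative bdiff (a k) (smoothing a f (Suc k)) t) (at t)"
  by (subst smoothing_unfold) (rule avg_has_derivative[OF smoothing_continuous a_pos])

end

text \<open>The quotient with step a k is taken first, before those of smaller index. In this order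
  the derivative of \<open>bdiffs a k (smoothing a f k)\<close> is literally
  \<open>bdiffs a (Suc k) (smoothing a f (Suc k))\<close>, as the new quotient arises next to the
  smoothing.\<close>

primrec bdiffs :: "(nat \<Rightarrow> real) \<Rightarrow> nat \<Rightarrow> (real \<Rightarrow> real) \<Rightarrow> real \<Rightarrow> real" where
  "bdiffs a 0 g = g"
| "bdiffs a (Suc k) g = bdiffs a k (bdiff (a k) g)"

lemma bdiffs_has_derivative:
  assumes "\<And>t. (g has_real_derivative g' t) (at t)"
  shows "(bdiffs a k g has_real_derivative bdiffs a k g' t) (at t)"
  using assms
proof (induction k arbitrary: g g' t)
  case (Suc k)
  have "(bdiff h g has_real_derivative bdiff h g' t) (at t)" for t h
  proof -
    have "((\<lambda>t. (g t - g (t - h)) * inverse h) has_real_derivative (g' t - g' (t - h) * 1) * inverse h) (at t)"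
      by (intro DERIV_cmult_right DERIV_diff Suc.prems DERIV_chain2[where f=g]) (auto intro!: derivative_eq_intros)
    then show ?thesis by (simp add: bdiff_def[abs_def] divide_inverse)
  qed
  then show ?case using Suc.IH by simp
qed simp

lemma bdiffs_zero:
  assumes "\<And>k. a k > 0" "\<And>t. t \<le> t0 \<Longrightarrow> g t = 0" "t \<le> t0"
  shows "bdiffs a k g t = 0"
  using assms
proof (induction k arbitrary: g t)
  case (Suc k)
  have "bdiff (a k) g t = 0" if "t \<le> t0" for t
    using Suc.prems(1)[of k] Suc.prems(2) that by (simp add: bdiff_def)
  then show ?case using Suc.IH Suc.prems by simp
qed simp

lemma bdiffs_bound:
  assumes "\<And>k. a k > 0" "\<And>t. \<bar>g t\<bar> \<le> M"
  shows "\<bar>bdiffs a k g t\<bar> \<le> M * (\<Prod>j<k. 2 / a j)"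
  using assms
proof (induction k arbitrary: g M t)
  case (Suc k)
  have "\<bar>bdiff (a k) g t\<bar> \<le> M * (2 / a k)" for t
  proof -
    have "\<bar>g t - g (t - a k)\<bar> \<le> 2 * M"
      using Suc.prems(2)[of t] Suc.prems(2)[of "t - a k"] by linarith
    then show ?thesis using Suc.prems(1)[of k] by (simp add: bdiff_def field_simps)
  qed
  then show ?case using Suc.IH[OF Suc.prems(1), of "bdiff (a k) g" "M * (2 / a k)"]
    by (simp add: ac_simps)
qed simp

section \<open>Higher derivatives of the smoothed function\<close>

context smoothing_setup
begin

lemma smoothing_derivatives:
  "(bdiffs a k (smoothing a f k) has_real_derivative bdiffs a (Suc k) (smoothing a f (Suc k)) t) (at t)"
  using bdiffs_has_derivative[OF smoothing_has_derivative] by simp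

lemma deriv_smoothing: "(deriv ^^ k) (smoothing a f 0) = bdiffs a k (smoothing a f k)"
proof (induction k)
  case (Suc k)
  then show ?case using DERIV_imp_deriv[OF smoothing_derivatives[of k]] by auto
qed simp

lemma smoothing_differentiable: "(deriv ^^ k) (smoothing a f 0) differentiable (at t)"
  unfolding deriv_smoothing using smoothing_derivatives real_differentiable_def by blast

end

section \<open>Lipschitz bound from the weak derivative\<close>

text \<open>A ramp of width d / 2 is smoothed with windows of total length d / 2; as the averages
  look only backwards, the transition stays inside [c, c + d].\<close>

lemma smooth_step_exists:
  fixes c d :: real
  assumes "d > 0"
  obtains P :: "real \<Rightarrow> real" where "\<And>n x. (deriv ^^ n) P differentiable (at x)" "mono P"
    "\<And>x. x \<le> c \<Longrightarrow> P x = 0" "\<And>x. c + d \<le> x \<Longrightarrow> P x = 1"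
proof -
  define f where "f x = max 0 (min 1 ((x - c) / (d / 2)))" for x
  define a where "a j = d / 2 * (1 / 2) ^ Suc j" for j :: nat
  have sums: "a sums (d / 2)"
    using sums_mult[OF power_half_series, of "d / 2"] by (simp add: a_def[abs_def])
  interpret smoothing_setup a f "2 / d"
  proof
    show "a k > 0" for k using assms by (simp add: a_def)
    show "summable a" using sums by (simp add: sums_iff)
    show "(2 / d)-lipschitz_on UNIV f"
    proof (rule lipschitz_onI)
      fix x y
      have "\<bar>f x - f y\<bar> \<le> \<bar>(x - c) / (d / 2) - (y - c) / (d / 2)\<bar>"
        unfolding f_def by (simp add: max_def min_def)
      also have "(x - c) / (d / 2) - (y - c) / (d / 2) = 2 / d * (x - y)"
        using assms by (simp add: field_simps)
      also have "\<bar>2 / d * (x - y)\<bar> = 2 / d * \<bar>x - y\<bar>"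
        unfolding abs_mult using assms by simp
      finally show "dist (f x) (f y) \<le> 2 / d * dist x y"
        unfolding dist_real_def .
    qed (use assms in simp)
  qed
  have tail: "tail_sum a 0 = d / 2"
    using sums by (simp add: tail_sum_def sums_iff)
  have "mono f"
  proof (rule monoI)
    fix x y :: real assume "x \<le> y"
    then have "(x - c) / (d / 2) \<le> (y - c) / (d / 2)"
      using assms by (intro divide_right_mono) auto
    then show "f x \<le> f y" unfolding f_def by (intro max.mono min.mono order_refl)
  qed
  moreover have "smoothing a f 0 x = 0" if "x \<le> c" for x
    using smoothing_bounds[of x 0 0 0] that assms by (simp add: f_def divide_nonpos_pos)
  moreover have "smoothing a f 0 x = 1" if "c + d \<le> x" for x
    using smoothing_bounds[of x 0 1 1] that assms tail by (simp add: f_def field_simps)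
  ultimately show thesis
    by (intro that[of "smoothing a f 0"] smoothing_differentiable smoothing_mono)
qed

section \<open>Essential bounds for continuous functions\<close>

lemma Linf_norm_AE:
  assumes "Linf T f"
  shows "AE t in lebesgue_on {0<..<T}. \<bar>f t\<bar> \<le> Linf_norm T f"
proof -
  let ?E = "esssup (lebesgue_on {0<..<T}) (\<lambda>t. ereal \<bar>f t\<bar>)"
  have fin: "?E < \<infinity>" using assms by (simp add: Linf_def)
  have "AE t in lebesgue_on {0<..<T}. ereal \<bar>f t\<bar> \<le> ?E" by (rule esssup_AE)
  then show ?thesis
  proof (rule AE_mp, intro AE_I2 impI)
    fix t assume "ereal \<bar>f t\<bar> \<le> ?E"
    then show "\<bar>f t\<bar> \<le> Linf_norm T f"
      using fin unfolding Linf_norm_def by (cases ?E) auto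
  qed
qed

text \<open>A subset of full measure is dense: otherwise the complement of its closure in the
  interval would be a nonempty open null set. For continuous functions this turns almost-everywhere
  bounds into bounds at all points.\<close>

lemma closure_AE_interval:
  fixes a b :: real
  assumes "AE t in lebesgue_on {a<..<b}. P t" "a < b"
  shows "closure {t \<in> {a<..<b}. P t} = {a..b}"
proof
  have "closure {t \<in> {a<..<b}. P t} \<subseteq> closure {a<..<b}" by (intro closure_mono) auto
  then show "closure {t \<in> {a<..<b}. P t} \<subseteq> {a..b}" using assms(2) by simp
  have "AE t in lebesgue. t \<in> {a<..<b} \<longrightarrow> P t"
    using assms(1) by (subst (asm) AE_restrict_space_iff) auto
  then obtain N where N: "N \<in> null_sets lebesgue" "{t. \<not> (t \<in> {a<..<b} \<longrightarrow> P t)} \<subseteq> N"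
    by (auto simp: eventually_ae_filter)
  have "{a<..<b} \<subseteq> closure {t \<in> {a<..<b}. P t}"
  proof (rule ccontr)
    assume "\<not> ?thesis"
    then have ne: "{a<..<b} - closure {t \<in> {a<..<b}. P t} \<noteq> {}" by blast
    have "{a<..<b} - closure {t \<in> {a<..<b}. P t} \<subseteq> N"
      using N(2) closure_subset[of "{t \<in> {a<..<b}. P t}"] by blast
    moreover have "negligible N" using N(1) by (simp add: negligible_iff_null_sets)
    ultimately have "negligible ({a<..<b} - closure {t \<in> {a<..<b}. P t})"
      using negligible_subset by blast
    then show False using ne open_not_negligible[of "{a<..<b} - closure {t \<in> {a<..<b}. P t}"]
      by (simp add: open_Diff)
  qed
  then have "closure {a<..<b} \<subseteq> closure {t \<in> {a<..<b}. P t}"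
    by (rule closure_minimal) simp
  then show "{a..b} \<subseteq> closure {t \<in> {a<..<b}. P t}" using assms(2) by simp
qed

lemma abs_le_Linf_norm:
  assumes "continuous_on {0..T} w" "Linf T w" "0 < T" "t \<in> {0..T}"
  shows "\<bar>w t\<bar> \<le> Linf_norm T w"
proof -
  let ?S = "{t \<in> {0<..<T}. \<bar>w t\<bar> \<le> Linf_norm T w}"
  have cl: "closure ?S = {0..T}"
    by (rule closure_AE_interval[OF Linf_norm_AE[OF assms(2)] assms(3)])
  show ?thesis
  proof (rule continuous_le_on_closure[where S="?S" and f="\<lambda>t. \<bar>w t\<bar>"])
    show "continuous_on (closure ?S) (\<lambda>t. \<bar>w t\<bar>)"
      unfolding cl by (intro continuous_on_rabs assms)
    show "t \<in> closure ?S" unfolding cl by (rule assms)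
  qed blast
qed

lemma Linf_norm_nonneg:
  assumes "Linf T f" "0 < T"
  shows "0 \<le> Linf_norm T f"
proof -
  have "closure {t \<in> {0<..<T}. \<bar>f t\<bar> \<le> Linf_norm T f} \<noteq> {}"
    using closure_AE_interval[OF Linf_norm_AE[OF assms(1)] assms(2)] assms(2) by simp
  then obtain t where "\<bar>f t\<bar> \<le> Linf_norm T f" by auto
  then show ?thesis by (meson abs_ge_zero order_trans)
qed

lemma lebesgue_on_open_interval:
  fixes h :: "real \<Rightarrow> real"
  assumes "continuous_on {a..b} h"
  shows integrable_lebesgue_on_Ioo: "integrable (lebesgue_on {a<..<b}) h"
    and integral_lebesgue_on_Ioo: "integral\<^sup>L (lebesgue_on {a<..<b}) h = integral {a..b} h"
proof -
  have "set_integrable lebesgue {a..b} h"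
    using absolutely_integrable_continuous_real[OF assms] .
  then have "set_integrable lebesgue {a<..<b} h"
    by (rule set_integrable_subset) auto
  then show int: "integrable (lebesgue_on {a<..<b}) h"
    by (simp add: integrable_restrict_space set_integrable_def)
  show "integral\<^sup>L (lebesgue_on {a<..<b}) h = integral {a..b} h"
    using lebesgue_integral_eq_integral[OF int] by (simp add: integral_open_interval_real)
qed

text \<open>The derivative of a step is an approximate point mass at c: nonnegative, zero off
  [c, c + d] and of integral 1. Integrating w against it gives w c up to the oscillation e of w
  there.\<close>

lemma integral_times_step_deriv:
  fixes P w :: "real \<Rightarrow> real"
  assumes P: "\<And>n x. (deriv ^^ n) P differentiable (at x)" "mono P"
    "\<And>x. x \<le> c \<Longrightarrow> P x = 0" "\<And>x. c + d \<le> x \<Longrightarrow> P x = 1"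
    and w: "continuous_on {0..T} w" and cd: "0 < c" "c + d < T" "0 < d"
    and e: "\<And>x. x \<in> {c..c + d} \<Longrightarrow> \<bar>w x - w c\<bar> \<le> e"
  shows "\<bar>integral {0..T} (\<lambda>x. w x * deriv P x) - w c\<bar> \<le> e"
proof -
  have DP: "(P has_real_derivative deriv P x) (at x)" for x
    using P(1)[of 0 x] by (simp add: DERIV_deriv_iff_real_differentiable)
  have cP: "continuous_on S (deriv P)" for S
    using P(1)[of 1]
    by (auto intro!: continuous_at_imp_continuous_on differentiable_imp_continuous_within)
  have nn: "deriv P x \<ge> 0" for x
    using mono_on_imp_deriv_nonneg[OF _ DP[of x], of UNIV] P(2) by simp
  have out: "deriv P x = 0" if "x \<notin> {c..c + d}" for x
  proof (cases "x < c")
    case True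
    have "(P has_real_derivative 0) (at x)"
      by (rule has_field_derivative_transform_within_open[where f="\<lambda>_. 0" and S="{..<c}"])
        (use True P(3) in auto)
    then show ?thesis by (rule DERIV_imp_deriv)
  next
    case False
    have "(P has_real_derivative 0) (at x)"
      by (rule has_field_derivative_transform_within_open[where f="\<lambda>_. 1" and S="{c + d<..}"])
        (use False that P(4) in auto)
    then show ?thesis by (rule DERIV_imp_deriv)
  qed
  \<comment> \<open>The mass is P T - P 0 = 1 - 0, as 0 < c and c + d < T place the step inside the
    interval.\<close>
  have FTC: "(deriv P has_integral 1) {0..T}"
    using fundamental_theorem_of_calculus[of 0 T P "deriv P"] DP P(3)[of 0] P(4)[of T] cd
    by (auto simp: has_real_derivative_iff_has_vector_derivative[symmetric] has_field_derivative_at_within)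
  have i1: "(\<lambda>x. w x * deriv P x) integrable_on {0..T}"
    by (intro integrable_continuous_real continuous_intros w cP)
  have hi: "((\<lambda>x. w x * deriv P x - w c * deriv P x) has_integral
      integral {0..T} (\<lambda>x. w x * deriv P x) - w c * 1) {0..T}"
    by (intro has_integral_diff integrable_integral i1 has_integral_mult_right FTC)
  have he: "((\<lambda>x. e * deriv P x) has_integral e * 1) {0..T}"
    by (intro has_integral_mult_right FTC)
  have bd: "norm (w x * deriv P x - w c * deriv P x) \<le> e * deriv P x" for x
  proof (cases "x \<in> {c..c + d}")
    case True
    then have "\<bar>w x - w c\<bar> * deriv P x \<le> e * deriv P x" using e nn by (intro mult_right_mono)
    then show ?thesis using nn[of x] by (simp add: abs_mult left_diff_distrib[symmetric])
  qed (simp add: out)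
  show ?thesis
    using Henstock_Kurzweil_Integration.integral_norm_bound_integral
      [OF has_integral_integrable[OF hi] has_integral_integrable[OF he] bd]
    unfolding integral_unique[OF hi] integral_unique[OF he] by simp
qed

section \<open>Testing the weak derivative with a difference of two steps\<close>

lemma deriv_funpow_diff:
  fixes P Q :: "real \<Rightarrow> real"
  assumes "\<And>n x. (deriv ^^ n) P differentiable (at x)" "\<And>n x. (deriv ^^ n) Q differentiable (at x)"
  shows "(deriv ^^ n) (\<lambda>x. P x - Q x) = (\<lambda>x. (deriv ^^ n) P x - (deriv ^^ n) Q x)"
proof (induction n)
  case (Suc n)
  have "deriv (\<lambda>x. (deriv ^^ n) P x - (deriv ^^ n) Q x) x
      = deriv ((deriv ^^ n) P) x - deriv ((deriv ^^ n) Q) x" for x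
    using assms by (intro DERIV_imp_deriv DERIV_diff)
      (simp_all add: DERIV_deriv_iff_real_differentiable)
  then show ?case by (simp add: Suc.IH fun_eq_iff)
qed simp

lemma mono_step_range:
  fixes P :: "real \<Rightarrow> real"
  assumes "mono P" "\<And>x. x \<le> c \<Longrightarrow> P x = 0" "\<And>x. c + d \<le> x \<Longrightarrow> P x = 1"
  shows "0 \<le> P x \<and> P x \<le> 1"
proof
  show "0 \<le> P x"
    using assms(2)[of x] assms(2)[of c] monoD[OF assms(1), of c x] by (cases "x \<le> c") auto
  show "P x \<le> 1"
    using assms(3)[of x] assms(3)[of "c + d"] monoD[OF assms(1), of x "c + d"]
    by (cases "c + d \<le> x") auto
qed

text \<open>The test function P - Q is a smoothed indicator of [a, b], so its derivative is nearly
  the point mass at a minus that at b. The weak identity equates w a - w b, up to 2 * e, with minus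
  the integral of g against a function bounded by 1 and supported in [a, b + d].\<close>

lemma weak_deriv_increment:
  assumes w: "continuous_on {0..T} w" and g: "Linf T g" "has_weak_deriv T w g"
    and ab: "0 < a" "a < b" "b + d < T" "0 < d"
    and ea: "\<And>x. x \<in> {a..a + d} \<Longrightarrow> \<bar>w x - w a\<bar> \<le> e"
    and eb: "\<And>x. x \<in> {b..b + d} \<Longrightarrow> \<bar>w x - w b\<bar> \<le> e"
  shows "\<bar>w a - w b\<bar> \<le> Linf_norm T g * (b + d - a) + 2 * e"
proof -
  obtain P where P: "\<And>n x. (deriv ^^ n) P differentiable (at x)" "mono P"
    "\<And>x. x \<le> a \<Longrightarrow> P x = 0" "\<And>x. a + d \<le> x \<Longrightarrow> P x = 1"
    using smooth_step_exists[OF ab(4), of a] by blast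
  obtain Q where Q: "\<And>n x. (deriv ^^ n) Q differentiable (at x)" "mono Q"
    "\<And>x. x \<le> b \<Longrightarrow> Q x = 0" "\<And>x. b + d \<le> x \<Longrightarrow> Q x = 1"
    using smooth_step_exists[OF ab(4), of b] by blast
  define \<phi> where "\<phi> x = P x - Q x" for x
  define N where "N = Linf_norm T g"
  have N0: "N \<ge> 0" unfolding N_def using Linf_norm_nonneg[OF g(1)] ab by linarith
  have out: "\<phi> x = 0" if "x \<notin> {a..b + d}" for x
  proof (cases "x < a")
    case True
    then show ?thesis using P(3)[of x] Q(3)[of x] ab by (simp add: \<phi>_def)
  next
    case False
    then show ?thesis using that P(4)[of x] Q(4)[of x] ab by (simp add: \<phi>_def)
  qed
  have \<phi>1: "\<bar>\<phi> x\<bar> \<le> 1" for x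
    using mono_step_range[of P a d x, OF P(2,3,4)] mono_step_range[of Q b d x, OF Q(2,3,4)] unfolding \<phi>_def by arith
  have dn: "(deriv ^^ n) \<phi> = (\<lambda>x. (deriv ^^ n) P x - (deriv ^^ n) Q x)" for n
    unfolding \<phi>_def by (rule deriv_funpow_diff[OF P(1) Q(1)])
  have dP: "continuous_on S (deriv P)" "continuous_on S (deriv Q)" for S
    using P(1)[of 1] Q(1)[of 1]
    by (auto intro!: continuous_at_imp_continuous_on differentiable_imp_continuous_within)
  have "continuous_on S P" "continuous_on S Q" for S
    using P(1)[of 0] Q(1)[of 0]
    by (auto intro!: continuous_at_imp_continuous_on differentiable_imp_continuous_within)
  then have c\<phi>: "continuous_on S \<phi>" for S
    unfolding \<phi>_def[abs_def] by (intro continuous_on_diff)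
  have sub: "closure {x. \<phi> x \<noteq> 0} \<subseteq> {a..b + d}"
    by (rule closure_minimal) (use out in blast, simp)
  have "test_function T \<phi>"
    unfolding test_function_def
  proof (intro conjI allI)
    show "(deriv ^^ n) \<phi> differentiable (at x)" for n x
      unfolding dn by (intro differentiable_diff P(1) Q(1))
    show "compact (closure {x. \<phi> x \<noteq> 0})"
      using bounded_subset[OF compact_imp_bounded[OF compact_Icc] sub]
      by (simp add: compact_eq_bounded_closed)
    show "closure {x. \<phi> x \<noteq> 0} \<subseteq> {0<..<T}" using sub ab by fastforce
  qed
  then have weak: "(\<integral>t. w t * deriv \<phi> t \<partial>lebesgue_on {0<..<T}) = - (\<integral>t. g t * \<phi> t \<partial>lebesgue_on {0<..<T})"
    using g(2) unfolding has_weak_deriv_def by blast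
  have d1: "deriv \<phi> t = deriv P t - deriv Q t" for t
    using dn[of 1] by simp
  have "(\<integral>t. w t * deriv \<phi> t \<partial>lebesgue_on {0<..<T}) = integral {0..T} (\<lambda>t. w t * deriv \<phi> t)"
    unfolding d1 by (intro integral_lebesgue_on_Ioo continuous_intros w dP)
  also have "\<dots> = integral {0..T} (\<lambda>t. w t * deriv P t - w t * deriv Q t)"
    by (simp add: d1 right_diff_distrib)
  also have "\<dots> = integral {0..T} (\<lambda>t. w t * deriv P t) - integral {0..T} (\<lambda>t. w t * deriv Q t)"
    by (intro integral_diff integrable_continuous_real continuous_intros w dP)
  finally have lhs: "(\<integral>t. w t * deriv \<phi> t \<partial>lebesgue_on {0<..<T})
    = integral {0..T} (\<lambda>t. w t * deriv P t) - integral {0..T} (\<lambda>t. w t * deriv Q t)" .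
  have "\<bar>integral {0..T} (\<lambda>x. w x * deriv P x) - w a\<bar> \<le> e"
    by (rule integral_times_step_deriv[where d=d]) (use P w ab ea in auto)
  moreover have "\<bar>integral {0..T} (\<lambda>x. w x * deriv Q x) - w b\<bar> \<le> e"
    by (rule integral_times_step_deriv[where d=d]) (use Q w ab eb in auto)
  moreover have "\<bar>\<integral>t. g t * \<phi> t \<partial>lebesgue_on {0<..<T}\<bar> \<le> N * (b + d - a)"
  proof -
    have "norm (\<integral>t. g t * \<phi> t \<partial>lebesgue_on {0<..<T}) \<le> (\<integral>t. norm (g t * \<phi> t) \<partial>lebesgue_on {0<..<T})"
      by (rule integral_norm_bound)
    also have "\<dots> \<le> (\<integral>t. N * \<bar>\<phi> t\<bar> \<partial>lebesgue_on {0<..<T})"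
    proof (rule integral_mono_AE')
      show "integrable (lebesgue_on {0<..<T}) (\<lambda>t. N * \<bar>\<phi> t\<bar>)"
        by (intro integrable_lebesgue_on_Ioo continuous_intros c\<phi>)
      show "AE t in lebesgue_on {0<..<T}. norm (g t * \<phi> t) \<le> N * \<bar>\<phi> t\<bar>"
        using Linf_norm_AE[OF g(1)]
        by (rule AE_mp) (auto simp: N_def abs_mult intro!: mult_right_mono)
      show "AE t in lebesgue_on {0<..<T}. 0 \<le> N * \<bar>\<phi> t\<bar>" using N0 by simp
    qed
    also have "\<dots> = integral {0..T} (\<lambda>t. N * \<bar>\<phi> t\<bar>)"
      by (intro integral_lebesgue_on_Ioo continuous_intros c\<phi>)
    also have "\<dots> \<le> integral {0..T} (\<lambda>t. if t \<in> {a..b + d} then N else 0)"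
    proof (rule integral_le)
      show "(\<lambda>t. N * \<bar>\<phi> t\<bar>) integrable_on {0..T}"
        by (intro integrable_continuous_real continuous_intros c\<phi>)
      show "(\<lambda>t. if t \<in> {a..b + d} then N else 0) integrable_on {0..T}"
        by (simp only: Henstock_Kurzweil_Integration.integrable_restrict_Int) auto
      show "N * \<bar>\<phi> t\<bar> \<le> (if t \<in> {a..b + d} then N else 0)" for t
        using out[of t] \<phi>1[of t] N0 by (auto intro: mult_left_le)
    qed
    also have "\<dots> = integral ({a..b + d} \<inter> {0..T}) (\<lambda>_. N)"
      by (simp only: Henstock_Kurzweil_Integration.integral_restrict_Int)
    also have "{a..b + d} \<inter> {0..T} = {a..b + d}" using ab by auto
    also have "integral {a..b + d} (\<lambda>_. N) = N * (b + d - a)" using ab by simp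
    finally show ?thesis by simp
  qed
  ultimately show ?thesis unfolding N_def using weak lhs by linarith
qed

text \<open>For interior points the step width and the oscillation in the previous estimate are made
  arbitrarily small; continuity then extends the bound to the end points.\<close>

lemma weak_deriv_lipschitz:
  assumes w: "continuous_on {0..T} w" and g: "Linf T g" "has_weak_deriv T w g" and T: "0 < T"
  shows "(Linf_norm T g)-lipschitz_on {0..T} w"
proof -
  define N where "N = Linf_norm T g"
  have N0: "N \<ge> 0" unfolding N_def using Linf_norm_nonneg[OF g(1) T] .
  have *: "\<bar>w a - w b\<bar> \<le> N * (b - a)" if ab: "0 < a" "a < b" "b < T" for a b
  proof (rule field_le_epsilon)
    fix \<eta> :: real assume \<eta>: "\<eta> > 0"
    \<comment> \<open>Chosen so that the total error N * d + 2 * e is at most \<eta> once d \<le>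
      e.\<close>
    define e where "e = \<eta> / (N + 2)"
    have e: "e > 0" "(N + 2) * e = \<eta>" using \<eta> N0 by (auto simp: e_def)
    have cont: "\<exists>d>0. \<forall>x\<in>{0..T}. dist x c < d \<longrightarrow> dist (w x) (w c) < e" if "c \<in> {0..T}" for c
      using w that e(1) unfolding continuous_on_iff by blast
    have "a \<in> {0..T}" "b \<in> {0..T}" using ab by auto
    note cont[OF this(1)] cont[OF this(2)]
    then obtain d1 d2 where d:
      "d1 > 0" "\<And>x. x \<in> {0..T} \<Longrightarrow> dist x a < d1 \<Longrightarrow> dist (w x) (w a) < e"
      "d2 > 0" "\<And>x. x \<in> {0..T} \<Longrightarrow> dist x b < d2 \<Longrightarrow> dist (w x) (w b) < e"
      by blast
    define m where "m = min (min d1 d2) (min e (T - b))"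
    define d where "d = m / 2"
    have "m \<le> d1" "m \<le> d2" "m \<le> e" "m \<le> T - b" "m > 0"
      using d(1,3) e(1) ab by (simp_all add: m_def)
    moreover have "m = 2 * d" by (simp add: d_def)
    ultimately have dd: "d > 0" "d < d1" "d < d2" "d \<le> e" "b + d < T"
      by linarith+
    have "\<bar>w a - w b\<bar> \<le> N * (b + d - a) + 2 * e"
      unfolding N_def
    proof (rule weak_deriv_increment[OF w g ab(1,2) dd(5,1)])
      show "\<bar>w x - w a\<bar> \<le> e" if "x \<in> {a..a + d}" for x
        using d(2)[of x] that dd ab by (auto simp: dist_real_def)
      show "\<bar>w x - w b\<bar> \<le> e" if "x \<in> {b..b + d}" for x
        using d(4)[of x] that dd ab by (auto simp: dist_real_def)
    qed
    moreover have "N * d \<le> N * e" using N0 dd by (intro mult_left_mono)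
    ultimately show "\<bar>w a - w b\<bar> \<le> N * (b - a) + \<eta>"
      using e(2) by (simp add: algebra_simps)
  qed
  have "N-lipschitz_on {0<..<T} w"
  proof (rule lipschitz_onI[OF _ N0])
    fix x y assume "x \<in> {0<..<T}" "y \<in> {0<..<T}"
    then show "dist (w x) (w y) \<le> N * dist x y"
      using *[of x y] *[of y x] by (cases x y rule: linorder_cases) (auto simp: dist_real_def abs_minus_commute)
  qed
  then have "N-lipschitz_on (closure {0<..<T}) w"
    by (rule lipschitz_on_closure) (use w T in simp)
  then show ?thesis using T by (simp add: N_def)
qed

section \<open>Power series solutions of the heat equation\<close>

text \<open>The offset j lets one formula hold both the solution (j = 1, odd powers) and its space
  derivative (j = 0, even powers). \<open>F k\<close> stands for the k-th time derivative of
  \<open>F 0\<close>.\<close>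

definition heat_series :: "nat \<Rightarrow> (nat \<Rightarrow> real \<Rightarrow> real) \<Rightarrow> real \<Rightarrow> real \<Rightarrow> real" where
  "heat_series j F t x = (\<Sum>k. F k t * (x ^ (2 * k + j) / fact (2 * k + j)))"

text \<open>The ratio (2k)! / (k!)^2 is a binomial coefficient, hence at least 1. The lower bound
  does not depend on j, so one majorant condition covers all offsets.\<close>

lemma fact_mono_square: "(fact k)\<^sup>2 \<le> (fact (2 * k + j) :: real)"
proof -
  have "fact k * fact k * (1::nat) \<le> fact k * fact k * ((2 * k) choose k)"
    by (intro mult_left_mono) (simp_all add: Suc_le_eq)
  also have "\<dots> = fact (2 * k)" using binomial_fact_lemma[of k "2 * k"] by (simp add: mult_2)
  also have "\<dots> \<le> fact (2 * k + j)" by (rule fact_mono) simp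
  finally have "real (fact k * fact k) \<le> real (fact (2 * k + j))" by (simp only: of_nat_le_iff mult_1_right)
  then show ?thesis by (simp add: power2_eq_square)
qed

text \<open>The bounds B hold for all times, which makes convergence uniform in t, and they are
  summable against every R^k, which makes it locally uniform in x on the whole line.\<close>

locale heat_coefficients =
  fixes F :: "nat \<Rightarrow> real \<Rightarrow> real" and B :: "nat \<Rightarrow> real"
  assumes F_deriv: "\<And>k t. (F k has_real_derivative F (Suc k) t) (at t)"
    and F_bound: "\<And>k t. \<bar>F k t\<bar> \<le> B k"
    and B_summable: "\<And>R. R > 0 \<Longrightarrow> summable (\<lambda>k. B k * R ^ k / (fact k)\<^sup>2)"
begin

lemma F_continuous: "continuous_on S (F k)"
  using F_deriv by (meson DERIV_isCont continuous_at_imp_continuous_on)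

lemma B_nonneg: "0 \<le> B k"
  using F_bound[of k 0] by (meson abs_ge_zero order_trans)

lemma majorant_summable:
  assumes "R > 0"
  shows "summable (\<lambda>k. B k * R ^ (2 * k + j) / (fact k)\<^sup>2)"
proof -
  have "summable (\<lambda>k. R ^ j * (B k * (R\<^sup>2) ^ k / (fact k)\<^sup>2))"
    using assms by (intro summable_mult B_summable) simp
  moreover have "R ^ j * (B k * (R\<^sup>2) ^ k / (fact k)\<^sup>2) = B k * R ^ (2 * k + j) / (fact k)\<^sup>2" for k
    by (simp only: power_add power_mult) simp
  ultimately show ?thesis by (simp only:)
qed

lemma term_bound:
  assumes "\<bar>x\<bar> \<le> R"
  shows "norm (F k t * (x ^ (2 * k + j) / fact (2 * k + j))) \<le> B k * R ^ (2 * k + j) / (fact k)\<^sup>2"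
proof -
  have "\<bar>x\<bar> ^ (2 * k + j) / fact (2 * k + j) \<le> R ^ (2 * k + j) / (fact k)\<^sup>2"
    using assms fact_mono_square[of k j] by (intro frac_le power_mono) auto
  then have "\<bar>F k t\<bar> * (\<bar>x\<bar> ^ (2 * k + j) / fact (2 * k + j)) \<le> B k * (R ^ (2 * k + j) / (fact k)\<^sup>2)"
    using F_bound B_nonneg by (intro mult_mono) auto
  then show ?thesis by (simp add: abs_mult power_abs)
qed

lemma terms_summable: "summable (\<lambda>k. F k t * (x ^ (2 * k + j) / fact (2 * k + j)))"
  by (rule summable_comparison_test'[OF majorant_summable[of "\<bar>x\<bar> + 1"] term_bound]) auto

lemma heat_series_bound:
  assumes "R > 0" "\<bar>x\<bar> \<le> R"
  shows "\<bar>heat_series j F t x\<bar> \<le> (\<Sum>k. B k * R ^ (2 * k + j) / (fact k)\<^sup>2)"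
  using norm_suminf_le[OF term_bound[OF assms(2)] majorant_summable[OF assms(1)]]
  by (simp add: heat_series_def)

lemma heat_series_continuous: "continuous_on S (\<lambda>(t, x). heat_series j F t x)"
proof -
  let ?u = "\<lambda>k (t, x). F k t * (x ^ (2 * k + j) / fact (2 * k + j))"
  have "isCont (\<lambda>(t, x). heat_series j F t x) (t0, x0)" for t0 x0
  proof -
    define R where "R = \<bar>x0\<bar> + 1"
    have R: "R > 0" by (simp add: R_def)
    let ?U = "UNIV \<times> {-R<..<R} :: (real \<times> real) set"
    have "uniform_limit ?U (\<lambda>n p. \<Sum>k<n. ?u k p) (\<lambda>p. \<Sum>k. ?u k p) sequentially"
    proof (rule Weierstrass_m_test[OF _ majorant_summable[OF R, of j]])
      show "norm (?u k p) \<le> B k * R ^ (2 * k + j) / (fact k)\<^sup>2" if "p \<in> ?U" for k p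
        using that term_bound[of "snd p" R k "fst p" j] by (auto simp: case_prod_unfold)
    qed
    moreover have "continuous_on ?U (\<lambda>p. \<Sum>k<n. ?u k p)" for n
      unfolding case_prod_beta
      by (intro continuous_intros continuous_on_compose2[OF F_continuous]) auto
    ultimately have "continuous_on ?U (\<lambda>p. \<Sum>k. ?u k p)"
      by (intro uniform_limit_theorem[where F=sequentially]) auto
    moreover have "open ?U" "(t0, x0) \<in> ?U" by (auto intro: open_Times simp: R_def)
    ultimately have "isCont (\<lambda>p. \<Sum>k. ?u k p) (t0, x0)"
      by (simp only: continuous_on_eq_continuous_at)
    then show ?thesis by (simp only: heat_series_def case_prod_unfold)
  qed
  then show ?thesis by (intro continuous_at_imp_continuous_on) auto
qed

end

text \<open>Differentiation in t only shifts F, so closure under the shift lets each fact about the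
  series be reused for its derivatives. Relative to the factorials the shift costs a factor (k+1)^2,
  which 4^(k+1) absorbs.\<close>

lemma (in heat_coefficients) heat_coefficients_Suc: "heat_coefficients (\<lambda>k. F (Suc k)) (\<lambda>k. B (Suc k))"
proof
  fix R :: real assume R: "R > 0"
  have "summable (\<lambda>k. B (Suc k) * (4 * R) ^ Suc k / (fact (Suc k))\<^sup>2)"
    \<comment> \<open>Summability at 4 * R instead of R supplies the spare factor 4^(k+1).\<close>
    using B_summable[of "4 * R"] R by (subst summable_Suc_iff) simp
  then have "summable (\<lambda>k. 1 / R * (B (Suc k) * (4 * R) ^ Suc k / (fact (Suc k))\<^sup>2))"
    by (rule summable_mult)
  then show "summable (\<lambda>k. B (Suc k) * R ^ k / (fact k)\<^sup>2)"
  proof (rule summable_comparison_test'[where N = 0])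
    fix k
    have "(real (Suc k))\<^sup>2 \<le> 4 ^ Suc k"
    proof -
      have "real (Suc k) \<le> 2 ^ Suc k" using of_nat_less_two_power[of "Suc k", where 'a=real] by linarith
      then have "(real (Suc k))\<^sup>2 \<le> (2 ^ Suc k)\<^sup>2" by (intro power_mono) auto
      also have "(2 ^ Suc k)\<^sup>2 = (4::real) ^ Suc k" 
          by (simp only: power2_eq_square power_mult_distrib[symmetric]) simp
      finally show ?thesis .
    qed
    then have "B (Suc k) * R ^ k / (fact k)\<^sup>2 * (real (Suc k))\<^sup>2 \<le> B (Suc k) * R ^ k / (fact k)\<^sup>2 * 4 ^ Suc k"
      using B_nonneg R by (intro mult_left_mono) auto
    then have "B (Suc k) * R ^ k / (fact k)\<^sup>2 \<le> B (Suc k) * R ^ k * 4 ^ Suc k / ((fact k)\<^sup>2 * (real (Suc k))\<^sup>2)"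
      by (simp add: divide_simps mult.commute)
    also have "\<dots> = 1 / R * (B (Suc k) * (4 * R) ^ Suc k / (fact (Suc k))\<^sup>2)"
      using R by (simp add: power_mult_distrib fact_Suc ac_simps)
    finally show "norm (B (Suc k) * R ^ k / (fact k)\<^sup>2) \<le> 1 / R * (B (Suc k) * (4 * R) ^ Suc k / (fact (Suc k))\<^sup>2)"
      using B_nonneg R by (simp add: abs_mult)
  qed
qed (use F_deriv F_bound in auto)

context heat_coefficients
begin

lemma heat_series_dt:
  "((\<lambda>t. heat_series j F t x) has_real_derivative heat_series j (\<lambda>k. F (Suc k)) t x) (at t)"
proof -
  interpret S: heat_coefficients "\<lambda>k. F (Suc k)" "\<lambda>k. B (Suc k)" by (rule heat_coefficients_Suc)
  show ?thesis
    unfolding heat_series_def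
  proof (rule has_field_derivative_series'(2)[where S=UNIV and ?x0.0=0
        and f="\<lambda>k t. F k t * (x ^ (2 * k + j) / fact (2 * k + j))"
        and f'="\<lambda>k t. F (Suc k) t * (x ^ (2 * k + j) / fact (2 * k + j))"])
    show "((\<lambda>t. F n t * (x ^ (2 * n + j) / fact (2 * n + j))) has_real_derivative
        F (Suc n) t * (x ^ (2 * n + j) / fact (2 * n + j))) (at t within UNIV)" for n t
      by (rule DERIV_cmult_right) (rule F_deriv)
    show "uniformly_convergent_on UNIV (\<lambda>n t. \<Sum>i<n. F (Suc i) t * (x ^ (2 * i + j) / fact (2 * i + j)))"
      by (rule Weierstrass_m_test'[OF _ S.majorant_summable[of "\<bar>x\<bar> + 1" j]]) (rule S.term_bound, auto)
  qed (rule terms_summable | simp)+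
qed

lemma heat_series_dx_1:
  "((\<lambda>x. heat_series 1 F t x) has_real_derivative heat_series 0 F t x) (at x)"
  unfolding heat_series_def
proof (rule has_field_derivative_series'(2)[where S="{-(\<bar>x\<bar> + 1)..\<bar>x\<bar> + 1}" and ?x0.0=0
      and f="\<lambda>k x. F k t * (x ^ (2 * k + 1) / fact (2 * k + 1))"
      and f'="\<lambda>k x. F k t * (x ^ (2 * k + 0) / fact (2 * k + 0))"])
  show "((\<lambda>x. F n t * (x ^ (2 * n + 1) / fact (2 * n + 1))) has_real_derivative
      F n t * (y ^ (2 * n + 0) / fact (2 * n + 0))) (at y within {-(\<bar>x\<bar> + 1)..\<bar>x\<bar> + 1})" for n y
  proof -
    have "((\<lambda>x. x ^ (2 * n + 1)) has_real_derivative real (2 * n + 1) * y ^ (2 * n)) (at y)"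
      using DERIV_pow[of "2 * n + 1" y UNIV] by simp
    then have "((\<lambda>x. F n t * (x ^ (2 * n + 1) / fact (2 * n + 1))) has_real_derivative
        F n t * (real (2 * n + 1) * y ^ (2 * n) / fact (2 * n + 1))) (at y)"
      by (intro DERIV_cmult DERIV_cdivide)
    moreover have "real (2 * n + 1) * y ^ (2 * n) / fact (2 * n + 1) = y ^ (2 * n) / fact (2 * n)"
      by (simp add: fact_Suc)
    ultimately show ?thesis by (simp add: has_field_derivative_at_within)
  qed
  show "uniformly_convergent_on {-(\<bar>x\<bar> + 1)..\<bar>x\<bar> + 1}
      (\<lambda>n x. \<Sum>i<n. F i t * (x ^ (2 * i + 0) / fact (2 * i + 0)))"
    by (rule Weierstrass_m_test'[OF _ majorant_summable[of "\<bar>x\<bar> + 1" 0]])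
      (rule term_bound, auto)
  show "x \<in> interior {-(\<bar>x\<bar> + 1)..\<bar>x\<bar> + 1}" by auto
qed (rule terms_summable | simp)+

text \<open>The constant term k = 0 disappears and the index moves by one, so the second space
  derivative of the j = 1 series is the series of the shifted sequence. That is also its time
  derivative, hence the heat equation.\<close>

lemma heat_series_dx_0:
  "((\<lambda>x. heat_series 0 F t x) has_real_derivative heat_series 1 (\<lambda>k. F (Suc k)) t x) (at x)"
proof -
  interpret S: heat_coefficients "\<lambda>k. F (Suc k)" "\<lambda>k. B (Suc k)" by (rule heat_coefficients_Suc)
  have eq: "heat_series 0 F t x = F 0 t + (\<Sum>k. F (Suc k) t * (x ^ (2 * k + 2) / fact (2 * k + 2)))" for x
    using suminf_split_head[OF terms_summable[of t x 0]] by (simp add: heat_series_def)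
  have "((\<lambda>x. \<Sum>k. F (Suc k) t * (x ^ (2 * k + 2) / fact (2 * k + 2))) has_real_derivative
      heat_series 1 (\<lambda>k. F (Suc k)) t x) (at x)"
    unfolding heat_series_def
  proof (rule has_field_derivative_series'(2)[where S="{-(\<bar>x\<bar> + 1)..\<bar>x\<bar> + 1}" and ?x0.0=0
        and f="\<lambda>k x. F (Suc k) t * (x ^ (2 * k + 2) / fact (2 * k + 2))"
        and f'="\<lambda>k x. F (Suc k) t * (x ^ (2 * k + 1) / fact (2 * k + 1))"])
    show "((\<lambda>x. F (Suc n) t * (x ^ (2 * n + 2) / fact (2 * n + 2))) has_real_derivative
        F (Suc n) t * (y ^ (2 * n + 1) / fact (2 * n + 1))) (at y within {-(\<bar>x\<bar> + 1)..\<bar>x\<bar> + 1})" for n y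
    proof -
      have "((\<lambda>x. x ^ (2 * n + 2)) has_real_derivative real (2 * n + 2) * y ^ (2 * n + 1)) (at y)"
        using DERIV_pow[of "2 * n + 2" y UNIV] by simp
      then have "((\<lambda>x. F (Suc n) t * (x ^ (2 * n + 2) / fact (2 * n + 2))) has_real_derivative
          F (Suc n) t * (real (2 * n + 2) * y ^ (2 * n + 1) / fact (2 * n + 2))) (at y)"
        by (intro DERIV_cmult DERIV_cdivide)
      moreover have "real (2 * n + 2) * y ^ (2 * n + 1) / fact (2 * n + 2) = y ^ (2 * n + 1) / fact (2 * n + 1)"
        using fact_Suc[of "2 * n + 1", where 'a=real] by (simp del: fact_Suc)
      ultimately show ?thesis by (simp only: has_field_derivative_at_within)
    qed
    show "uniformly_convergent_on {-(\<bar>x\<bar> + 1)..\<bar>x\<bar> + 1}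
        (\<lambda>n x. \<Sum>i<n. F (Suc i) t * (x ^ (2 * i + 1) / fact (2 * i + 1)))"
      by (rule Weierstrass_m_test'[OF _ S.majorant_summable[of "\<bar>x\<bar> + 1" 1]])
        (rule S.term_bound, auto)
    show "x \<in> interior {-(\<bar>x\<bar> + 1)..\<bar>x\<bar> + 1}" by auto
  qed (rule S.terms_summable | simp)+
  then have "((\<lambda>x. F 0 t + (\<Sum>k. F (Suc k) t * (x ^ (2 * k + 2) / fact (2 * k + 2)))) has_real_derivative
      0 + heat_series 1 (\<lambda>k. F (Suc k)) t x) (at x)"
    by (intro DERIV_add DERIV_const)
  then show ?thesis by (simp only: eq add_0_left)
qed

lemma heat_series_0_at_0: "heat_series 0 F t 0 = F 0 t"
  using suminf_finite[of "{0}" "\<lambda>k. F k t * (0 ^ (2 * k + 0) / fact (2 * k + 0))"]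
  by (simp add: heat_series_def)

text \<open>Odd powers vanish at x = 0, and the vanishing of all coefficients at t = 0 is the
  initial condition. The series is continuous on the whole plane, in particular up to the
  corners.\<close>

lemma heat_series_solution:
  assumes "\<And>k. F k 0 = 0"
  shows "heat_solution L T (\<lambda>t. heat_series 1 F t L) (heat_series 1 F)"
proof -
  interpret S: heat_coefficients "\<lambda>k. F (Suc k)" "\<lambda>k. B (Suc k)" by (rule heat_coefficients_Suc)
  have d: "deriv (\<lambda>\<tau>. heat_series 1 F \<tau> x) t = heat_series 1 (\<lambda>k. F (Suc k)) t x"
    "deriv (heat_series 1 F t) = heat_series 0 F t"
    "deriv (heat_series 0 F t) = heat_series 1 (\<lambda>k. F (Suc k)) t" for t x
    using DERIV_imp_deriv[OF heat_series_dt] DERIV_imp_deriv[OF heat_series_dx_1]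
      DERIV_imp_deriv[OF heat_series_dx_0] by auto
  have diff: "(\<lambda>\<tau>. heat_series 1 F \<tau> x) differentiable (at t)"
    "heat_series 1 F t differentiable (at x)" "heat_series 0 F t differentiable (at x)" for t x
    unfolding real_differentiable_def
    by (rule exI, rule heat_series_dt heat_series_dx_1 heat_series_dx_0)+
  have zero: "heat_series 1 F t 0 = 0" "heat_series 1 F 0 x = 0" for t x
    using assms by (simp_all add: heat_series_def)
  show ?thesis
    unfolding heat_solution_def d
    using heat_series_continuous S.heat_series_continuous diff zero by simp
qed

end

section \<open>Uniqueness for the heat equation\<close>

text \<open>If D were positive, f' would vanish at the maximum x and be positive just to the right
  of it, and the mean value theorem would give larger values there.\<close>

lemma second_deriv_nonpos_at_max:
  fixes f f' :: "real \<Rightarrow> real"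
  assumes f: "\<And>y. y \<in> {a<..<b} \<Longrightarrow> (f has_real_derivative f' y) (at y)"
    and f': "(f' has_real_derivative D) (at x)"
    and x: "x \<in> {a<..<b}" and max: "\<And>y. y \<in> {a<..<b} \<Longrightarrow> f y \<le> f x"
  shows "D \<le> 0"
proof (rule ccontr)
  assume "\<not> D \<le> 0"
  then have "D > 0" by simp
  have "f' x = 0"
  proof (rule DERIV_local_max[OF f[OF x]])
    show "0 < min (x - a) (b - x)" using x by simp
    show "\<forall>y. \<bar>x - y\<bar> < min (x - a) (b - x) \<longrightarrow> f y \<le> f x"
      using max by (auto simp: abs_less_iff)
  qed
  moreover obtain d where d: "d > 0" "\<And>h. 0 < h \<Longrightarrow> h < d \<Longrightarrow> f' x < f' (x + h)"
    using DERIV_pos_inc_right[OF f' \<open>D > 0\<close>] by blast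
  define h where "h = min d (b - x) / 2"
  have h: "0 < h" "h < d" "x + h < b" using d(1) x by (auto simp: h_def min_def field_simps)
  obtain z where z: "x < z" "z < x + h" "f (x + h) - f x = (x + h - x) * f' z"
    using MVT2[of x "x + h" f f'] f h x by auto
  have "f' x < f' z" using d(2)[of "z - x"] z h by simp
  with \<open>f' x = 0\<close> z(3) h(1) have "f (x + h) > f x" by (simp add: algebra_simps)
  moreover have "f (x + h) \<le> f x" using max h x by simp
  ultimately show False by simp
qed

text \<open>Comparison is with earlier times only, since a maximum over a closed time interval may
  be attained at its last instant.\<close>

lemma deriv_nonneg_at_left_max:
  fixes f :: "real \<Rightarrow> real"
  assumes f: "(f has_real_derivative D) (at t)" and "a < t"
    and max: "\<And>s. s \<in> {a<..t} \<Longrightarrow> f s \<le> f t"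
  shows "0 \<le> D"
proof (rule ccontr)
  assume "\<not> 0 \<le> D"
  then obtain d where d: "d > 0" "\<And>h. 0 < h \<Longrightarrow> h < d \<Longrightarrow> f t < f (t - h)"
    using DERIV_neg_dec_left[OF f] by auto
  define h where "h = min d (t - a) / 2"
  have h: "0 < h" "h < d" "a < t - h" using d(1) \<open>a < t\<close> by (auto simp: h_def min_def field_simps)
  have "f t < f (t - h)" using d(2) h by blast
  moreover have "f (t - h) \<le> f t" using max h by simp
  ultimately show False by simp
qed

text \<open>The equation is encoded by using the same q as time derivative and as second space
  derivative. At a positive maximum of the tilted function u - \<eta> * t, necessarily at positive
  time and interior in space, q \<ge> \<eta> and q \<le> 0 contradict each other.\<close>

lemma heat_max_principle:
  fixes u ux q :: "real \<Rightarrow> real \<Rightarrow> real"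
  assumes cont: "continuous_on ({0..T} \<times> {0..L}) (\<lambda>(t, x). u t x)"
    and ut: "\<And>t x. t \<in> {0<..<T} \<Longrightarrow> x \<in> {0<..<L} \<Longrightarrow> ((\<lambda>\<tau>. u \<tau> x) has_real_derivative q t x) (at t)"
    and ux: "\<And>t x. t \<in> {0<..<T} \<Longrightarrow> x \<in> {0<..<L} \<Longrightarrow> (u t has_real_derivative ux t x) (at x)"
    and uxx: "\<And>t x. t \<in> {0<..<T} \<Longrightarrow> x \<in> {0<..<L} \<Longrightarrow> (ux t has_real_derivative q t x) (at x)"
    and bdry: "\<And>t. t \<in> {0<..<T} \<Longrightarrow> u t 0 \<le> 0" "\<And>t. t \<in> {0<..<T} \<Longrightarrow> u t L \<le> 0"
    and init: "\<And>x. x \<in> {0..L} \<Longrightarrow> u 0 x \<le> 0"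
    and t0: "t0 \<in> {0<..<T}" and x0: "x0 \<in> {0..L}"
  shows "u t0 x0 \<le> 0"
proof (rule ccontr)
  assume "\<not> u t0 x0 \<le> 0"
  then have pos: "u t0 x0 > 0" by simp
  \<comment> \<open>Half of the largest tilt that keeps the tilted function nonnegative at (t0,
    x0).\<close>
  define \<eta> where "\<eta> = u t0 x0 / (2 * t0)"
  have \<eta>: "\<eta> > 0" "u t0 x0 - \<eta> * t0 > 0" using pos t0 by (auto simp: \<eta>_def)
  let ?v = "\<lambda>p. u (fst p) (snd p) - \<eta> * fst p"
  \<comment> \<open>The cylinder stops at t0 < T, so the derivatives exist also at its final
    time.\<close>
  have "continuous_on ({0..t0} \<times> {0..L}) (\<lambda>p. u (fst p) (snd p))"
    using cont unfolding case_prod_unfold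
    by (rule continuous_on_subset) (use t0 in auto)
  then have "continuous_on ({0..t0} \<times> {0..L}) ?v" by (intro continuous_intros)
  moreover have "compact ({0..t0} \<times> {0..L})" by (intro compact_Times compact_Icc)
  moreover have p0: "(t0, x0) \<in> {0..t0} \<times> {0..L}" using t0 x0 by auto
  ultimately obtain p where p: "p \<in> {0..t0} \<times> {0..L}" "\<And>p'. p' \<in> {0..t0} \<times> {0..L} \<Longrightarrow> ?v p' \<le> ?v p"
    using continuous_attains_sup[of "{0..t0} \<times> {0..L}" ?v] by blast
  obtain t x where px: "p = (t, x)" by (cases p)
  have tx: "t \<in> {0..t0}" "x \<in> {0..L}" using p(1) px by auto
  have max: "u s y - \<eta> * s \<le> u t x - \<eta> * t" if "s \<in> {0..t0}" "y \<in> {0..L}" for s y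
    using p(2)[of "(s, y)"] that px by simp
  have vpos: "u t x - \<eta> * t > 0" using max[of t0 x0] \<eta>(2) t0 x0 by auto
  have "t \<noteq> 0" using vpos init[OF tx(2)] by auto
  then have t: "0 < t" "t \<le> t0" "t \<in> {0<..<T}" using tx t0 by auto
  have "\<eta> * t > 0" using \<eta>(1) t(1) by simp
  then have upos: "u t x > 0" using vpos by simp
  have x: "x \<in> {0<..<L}" using upos bdry[OF t(3)] tx(2) by (cases "x = 0"; cases "x = L") auto
  have "((\<lambda>\<tau>. u \<tau> x - \<eta> * \<tau>) has_real_derivative q t x - \<eta> * 1) (at t)"
    by (intro DERIV_diff DERIV_cmult DERIV_ident ut t x)
  then have "0 \<le> q t x - \<eta> * 1"
    by (rule deriv_nonneg_at_left_max[where a=0]) (use t tx in \<open>auto intro: max\<close>)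
  moreover have "q t x \<le> 0"
  proof (rule second_deriv_nonpos_at_max[OF ux[OF t(3)] uxx[OF t(3) x] x])
    show "u t y \<le> u t x" if "y \<in> {0<..<L}" for y
      using max[of t y] that tx by auto
  qed
  ultimately show False using \<eta>(1) by simp
qed

text \<open>The maximum principle is applied to y - z and to z - y. A solution has its data
  prescribed on open intervals only, so continuity is used to reach the corners at time 0 and, at
  the end, the times 0 and T.\<close>

lemma heat_solution_unique:
  assumes y: "heat_solution L T v y" and z: "heat_solution L T v z"
    and LT: "0 < L" "0 < T" and t: "t \<in> {0..T}" and x: "x \<in> {0..L}"
  shows "y t x = z t x"
proof -
  have init: "y 0 x = 0" if y: "heat_solution L T v y" and x: "x \<in> {0..L}" for y x
  proof (rule continuous_constant_on_closure[of "{0<..<L}" "y 0"])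
    have "continuous_on ({0..T} \<times> {0..L}) (\<lambda>(t, x). y t x)" using y by (simp add: heat_solution_def)
    then have "continuous_on {0..L} (\<lambda>x. (\<lambda>(t, x). y t x) (0, x))"
      by (rule continuous_on_compose2) (use LT in \<open>auto intro!: continuous_intros\<close>)
    then show "continuous_on (closure {0<..<L}) (y 0)" using LT by simp
    show "y 0 x = 0" if "x \<in> {0<..<L}" for x using y that by (simp add: heat_solution_def)
    show "x \<in> closure {0<..<L}" using x LT by simp
  qed
  have le: "y t x - z t x \<le> 0"
    if y: "heat_solution L T v y" and z: "heat_solution L T v z" and t: "t \<in> {0<..<T}" and x: "x \<in> {0..L}"
    for y z t x
  proof (rule heat_max_principle[where T=T and L=L and u="\<lambda>t x. y t x - z t x"
        and ux="\<lambda>t x. deriv (y t) x - deriv (z t) x"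
        and q="\<lambda>t x. deriv (deriv (y t)) x - deriv (deriv (z t)) x"])
    show "continuous_on ({0..T} \<times> {0..L}) (\<lambda>(t, x). y t x - z t x)"
      using y z unfolding heat_solution_def case_prod_unfold by (intro continuous_on_diff) auto
    fix t x assume t: "t \<in> {0<..<T}"
    show "y t 0 - z t 0 \<le> 0" "y t L - z t L \<le> 0"
      using y z t by (simp_all add: heat_solution_def)
    assume x: "x \<in> {0<..<L}"
    have D: "((\<lambda>\<tau>. w \<tau> x) has_real_derivative deriv (deriv (w t)) x) (at t)"
      "(w t has_real_derivative deriv (w t) x) (at x)"
      "(deriv (w t) has_real_derivative deriv (deriv (w t)) x) (at x)"
      if "heat_solution L T v w" for w
    proof -
      have "(\<lambda>\<tau>. w \<tau> x) differentiable (at t)" "w t differentiable (at x)" "deriv (w t) differentiable (at x)"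
        and eq: "deriv (\<lambda>\<tau>. w \<tau> x) t = deriv (deriv (w t)) x"
        using that t x unfolding heat_solution_def by auto
      then show "((\<lambda>\<tau>. w \<tau> x) has_real_derivative deriv (deriv (w t)) x) (at t)"
        "(w t has_real_derivative deriv (w t) x) (at x)"
        "(deriv (w t) has_real_derivative deriv (deriv (w t)) x) (at x)"
        by (simp_all only: DERIV_deriv_iff_real_differentiable[symmetric] eq)
    qed
    show "((\<lambda>\<tau>. y \<tau> x - z \<tau> x) has_real_derivative deriv (deriv (y t)) x - deriv (deriv (z t)) x) (at t)"
      "((\<lambda>x. y t x - z t x) has_real_derivative deriv (y t) x - deriv (z t) x) (at x)"
      "((\<lambda>x. deriv (y t) x - deriv (z t) x) has_real_derivative
        deriv (deriv (y t)) x - deriv (deriv (z t)) x) (at x)"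
      by (intro DERIV_diff D y z)+
  qed (use init[OF y] init[OF z] t x in auto)
  have "y t x - z t x = 0"
  proof (rule continuous_constant_on_closure[of "{0<..<T}" "\<lambda>t. y t x - z t x"])
    have "continuous_on {0..T} (\<lambda>t. w t x)" if "heat_solution L T v w" for w
    proof -
      have "continuous_on ({0..T} \<times> {0..L}) (\<lambda>(t, x). w t x)" using that by (simp add: heat_solution_def)
      then have "continuous_on {0..T} (\<lambda>t. (\<lambda>(t, x). w t x) (t, x))"
        by (rule continuous_on_compose2) (use x in \<open>auto intro!: continuous_intros\<close>)
      then show ?thesis by simp
    qed
    then show "continuous_on (closure {0<..<T}) (\<lambda>t. y t x - z t x)"
      using y z LT by (simp add: continuous_on_diff)
    show "y t x - z t x = 0" if "t \<in> {0<..<T}" for t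
      using le[OF y z that x] le[OF z y that x] by simp
    show "t \<in> closure {0<..<T}" using t LT by simp
  qed
  then show ?thesis by simp
qed

section \<open>Gevrey estimates and the control\<close>

lemma power_div_fact_le_exp:
  fixes x :: real
  assumes "0 \<le> x"
  shows "x ^ k / fact k \<le> exp x"
proof -
  have "(\<Sum>n\<in>{k}. x ^ n / fact n) \<le> (\<Sum>n. x ^ n / fact n)"
    using assms summable_exp_generic[of x]
    by (intro sum_le_suminf) (auto simp: scaleR_conv_of_real divide_inverse mult.commute)
  then show ?thesis by (simp add: exp_def scaleR_conv_of_real divide_inverse mult.commute)
qed

text \<open>With Y = X^(1/s), the k-th term is ((2 Y)^k / k!)^s * 2^(-s k). The first factor is at
  most (exp (2 Y))^s; doubling Y is what pays for the geometric factor.\<close>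

lemma power_series_fact_powr:
  fixes X s :: real
  assumes "0 < s" "0 < X"
  shows summable_power_fact_powr: "summable (\<lambda>k. X ^ k / fact k powr s)"
    and suminf_power_fact_powr:
      "(\<Sum>k. X ^ k / fact k powr s) \<le> exp (2 * s * X powr (1 / s)) / (1 - 2 powr - s)"
proof -
  define q :: real where "q = 2 powr - s"
  define Y where "Y = X powr (1 / s)"
  have Y: "Y > 0" "Y powr s = X" using assms by (auto simp: Y_def powr_powr)
  have "q < 2 powr 0" unfolding q_def using assms by (intro powr_less_mono) auto
  then have q: "0 < q" "q < 1" by (auto simp: q_def)
  have power_powr: "(W powr s) ^ k = (W ^ k) powr s" if "W > 0" for W :: real and k
  proof -
    have "(W powr s) ^ k = W powr (s * real k)" using that powr_realpow[of "W powr s" k] by (simp add: powr_powr)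
    also have "\<dots> = (W powr real k) powr s" by (simp only: powr_powr mult.commute)
    also have "W powr real k = W ^ k" using that by (rule powr_realpow)
    finally show ?thesis .
  qed
  have *: "X ^ k / fact k powr s \<le> exp (2 * s * Y) * q ^ k" for k
  proof -
    have "(2 * Y) powr s * q = X"
      using Y assms by (simp add: powr_mult q_def powr_minus)
    then have "X ^ k = ((2 * Y) powr s) ^ k * q ^ k" by (simp only: power_mult_distrib[symmetric])
    also have "((2 * Y) powr s) ^ k = ((2 * Y) ^ k) powr s"
      using Y by (intro power_powr) simp
    finally have "X ^ k / fact k powr s = ((2 * Y) ^ k / fact k) powr s * q ^ k"
      using Y by (simp add: powr_divide)
    also have "\<dots> \<le> exp (2 * Y) powr s * q ^ k"
      using Y q assms by (intro mult_right_mono powr_mono2 power_div_fact_le_exp) auto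
    also have "exp (2 * Y) powr s = exp (2 * s * Y)" by (simp add: powr_def mult.commute mult.left_commute)
    finally show ?thesis .
  qed
  have sq: "summable (\<lambda>k. exp (2 * s * Y) * q ^ k)"
    using q by (intro summable_mult summable_geometric) simp
  show sm: "summable (\<lambda>k. X ^ k / fact k powr s)"
    using sq by (rule summable_comparison_test'[where N=0]) (use * assms in auto)
  have "(\<Sum>k. X ^ k / fact k powr s) \<le> (\<Sum>k. exp (2 * s * Y) * q ^ k)"
    by (rule suminf_le[OF * sm sq])
  also have "\<dots> = exp (2 * s * Y) / (1 - q)"
    using q by (subst suminf_mult) (auto simp: suminf_geometric intro: summable_geometric)
  finally show "(\<Sum>k. X ^ k / fact k powr s) \<le> exp (2 * s * X powr (1 / s)) / (1 - 2 powr - s)"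
    by (simp add: q_def Y_def)
qed

text \<open>For r > 1 this is the Riemann zeta function at r; it normalises the windows (j+1)^(-r)
  to a prescribed total.\<close>

definition zeta_sum :: "real \<Rightarrow> real" where
  "zeta_sum r = (\<Sum>j. real (Suc j) powr - r)"

lemma zeta_sum_sums:
  assumes "1 < r"
  shows "(\<lambda>j. real (Suc j) powr - r) sums zeta_sum r" "zeta_sum r > 0"
proof -
  have "summable (\<lambda>j. real j powr - r)" using assms by (simp add: summable_real_powr_iff)
  then have sm: "summable (\<lambda>j. real (Suc j) powr - r)" by (subst summable_Suc_iff)
  then show "(\<lambda>j. real (Suc j) powr - r) sums zeta_sum r"
    unfolding zeta_sum_def by (rule summable_sums)
  show "zeta_sum r > 0" unfolding zeta_sum_def by (rule suminf_pos[OF sm]) simp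
qed

text \<open>Collects the construction for one scale \<delta>, the total of the windows. The product
  of 2 / a j over j < k is K^k (k!)^(2-s), and division by (k!)^2 leaves the series of X^k / (k!)^s
  with X = K * L^2.\<close>

lemma gevrey_heat_coefficients:
  fixes f :: "real \<Rightarrow> real"
  assumes s: "0 < s" "s < 1" and \<delta>: "0 < \<delta>" and L: "0 < L"
    and lip: "G-lipschitz_on UNIV f" and M: "\<And>t. \<bar>f t\<bar> \<le> M" and f0: "\<And>t. t \<le> 0 \<Longrightarrow> f t = 0"
  obtains F B where "heat_coefficients F B" "\<And>k. F k 0 = 0" "\<And>t. \<bar>F 0 t - f t\<bar> \<le> G * \<delta>"
    "\<And>t. \<bar>heat_series 1 F t L\<bar> \<le>
      M * (L / (1 - 2 powr - s) * exp (2 * s * (2 * zeta_sum (2 - s) / \<delta> * L\<^sup>2) powr (1 / s)))"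
proof -
  define Z where "Z = zeta_sum (2 - s)"
  have Z: "(\<lambda>j. real (Suc j) powr (s - 2)) sums Z" "Z > 0"
    using zeta_sum_sums[of "2 - s"] s by (simp_all add: Z_def)
  define a where "a j = \<delta> / Z * real (Suc j) powr (s - 2)" for j
  have a_sums: "a sums \<delta>" using sums_mult[OF Z(1), of "\<delta> / Z"] Z(2) by (simp add: a_def[abs_def])
  interpret smoothing_setup a f G
    by unfold_locales (use a_sums lip \<delta> Z in \<open>auto simp: a_def sums_iff\<close>)
  have tail: "tail_sum a 0 = \<delta>" using a_sums by (simp add: tail_sum_def sums_iff)
  define F where "F k = bdiffs a k (smoothing a f k)" for k
  \<comment> \<open>This is 2 / a 0; the general factor 2 / a j is K * (j+1)^(2-s).\<close>
  define K where "K = 2 * Z / \<delta>"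
  define B where "B k = M * (K ^ k * fact k powr (2 - s))" for k
  have K: "K > 0" using Z \<delta> by (simp add: K_def)
  have M0: "M \<ge> 0" using M[of 0] by linarith
  have prod: "(\<Prod>j<k. 2 / a j) = K ^ k * fact k powr (2 - s)" for k
  proof (induction k)
    case (Suc k)
    have "2 / a k = K * real (Suc k) powr (2 - s)"
    proof -
      have "real (Suc k) powr (s - 2) = 1 / real (Suc k) powr (2 - s)"
        using powr_minus_divide[of "real (Suc k)" "2 - s"] by simp
      then show ?thesis unfolding a_def K_def by simp
    qed
    moreover have "fact (Suc k) powr (2 - s) = real (Suc k) powr (2 - s) * fact k powr (2 - s)"
      unfolding fact_Suc by (simp only: powr_mult)
    ultimately show ?case using Suc by simp
  qed simp
  have series: "B k * R ^ k / (fact k)\<^sup>2 = M * ((K * R) ^ k / fact k powr s)" for k R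
  proof -
    have "fact k powr (2 - s) / (fact k)\<^sup>2 = 1 / fact k powr s"
      by (simp add: powr_diff)
    moreover have "B k * R ^ k / (fact k)\<^sup>2 = M * (K * R) ^ k * (fact k powr (2 - s) / (fact k)\<^sup>2)"
      by (simp add: B_def power_mult_distrib)
    ultimately show ?thesis by simp
  qed
  have FB: "heat_coefficients F B"
  proof
    show "(F k has_real_derivative F (Suc k) t) (at t)" for k t
      unfolding F_def by (rule smoothing_derivatives)
    show "\<bar>F k t\<bar> \<le> B k" for k t
    proof -
      have "- M \<le> f x \<and> f x \<le> M" for x using M[of x] by linarith
      then have "\<bar>smoothing a f k u\<bar> \<le> M" for u using smoothing_bounds[of u k "- M" M] by (simp add: abs_le_iff)
      then show ?thesis
        unfolding F_def B_def prod[symmetric] by (intro bdiffs_bound a_pos)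
    qed
    show "summable (\<lambda>k. B k * R ^ k / (fact k)\<^sup>2)" if "R > 0" for R
      unfolding series using summable_power_fact_powr[of s "K * R"] s K that by (intro summable_mult) simp
  qed
  interpret heat_coefficients F B by (rule FB)
  show thesis
  proof
    show "heat_coefficients F B" by (rule FB)
    show "F k 0 = 0" for k
      unfolding F_def
    \<comment> \<open>Both the averages and the difference quotients look back from t = 0, to times
      where f vanishes.\<close>
    proof (rule bdiffs_zero[where t0=0, OF a_pos])
      show "smoothing a f k t = 0" if "t \<le> 0" for t
        using smoothing_bounds[of t k 0 0] f0 that by simp
    qed simp
    show "\<bar>F 0 t - f t\<bar> \<le> G * \<delta>" for t
    proof -
      \<comment> \<open>Only times within \<delta> before t contribute to the smoothing at
        t.\<close>
      have "f t - G * \<delta> \<le> f x \<and> f x \<le> f t + G * \<delta>" if "t - \<delta> \<le> x" "x \<le> t" for x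
      proof -
        have "\<bar>f t - f x\<bar> \<le> G * \<bar>t - x\<bar>" using lipschitz_onD[OF lip, of t x] by (simp add: dist_real_def)
        also have "\<dots> \<le> G * \<delta>" using that lipschitz_on_nonneg[OF lip] by (intro mult_left_mono) auto
        finally show ?thesis by linarith
      qed
      then show ?thesis
        using smoothing_bounds[of t 0 "f t - G * \<delta>" "f t + G * \<delta>"] tail by (simp add: F_def abs_le_iff)
    qed
    show "\<bar>heat_series 1 F t L\<bar> \<le>
      M * (L / (1 - 2 powr - s) * exp (2 * s * (2 * zeta_sum (2 - s) / \<delta> * L\<^sup>2) powr (1 / s)))" for t
    proof -
      have KL: "0 < K * L\<^sup>2" using K L by simp
      have "\<bar>heat_series 1 F t L\<bar> \<le> (\<Sum>k. B k * L ^ (2 * k + 1) / (fact k)\<^sup>2)"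
        using L by (intro heat_series_bound) auto
      also have "(\<lambda>k. B k * L ^ (2 * k + 1) / (fact k)\<^sup>2) = (\<lambda>k. (M * L) * ((K * L\<^sup>2) ^ k / fact k powr s))"
      proof
        fix k
        have "B k * L ^ (2 * k + 1) / (fact k)\<^sup>2 = L * (B k * (L\<^sup>2) ^ k / (fact k)\<^sup>2)"
          by (simp add: power_mult)
        then show "B k * L ^ (2 * k + 1) / (fact k)\<^sup>2 = (M * L) * ((K * L\<^sup>2) ^ k / fact k powr s)"
          unfolding series by simp
      qed
      also have "(\<Sum>k. (M * L) * ((K * L\<^sup>2) ^ k / fact k powr s)) = M * L * (\<Sum>k. (K * L\<^sup>2) ^ k / fact k powr s)"
        by (rule suminf_mult[OF summable_power_fact_powr[OF s(1) KL]])
      also have "\<dots> \<le> M * L * (exp (2 * s * (K * L\<^sup>2) powr (1 / s)) / (1 - 2 powr - s))"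
        using M0 L by (intro mult_left_mono suminf_power_fact_powr s KL) auto
      finally show ?thesis by (simp add: K_def Z_def)
    qed
  qed
qed

lemma C0_norm_le:
  assumes "0 < T" "\<And>t. t \<in> {0..T} \<Longrightarrow> \<bar>f t\<bar> \<le> c"
  shows "C0_norm T f \<le> c"
  unfolding C0_norm_def using assms by (intro cSUP_least) auto

theorem mainTheorem1:
  fixes L T :: real
  assumes "L > 0" and "T > 0"
  shows "\<forall>s::real. 0 < s \<and> s < 1 \<longrightarrow>
    (\<exists>C>0. \<forall>w. W1inf T w \<and> w 0 = 0 \<longrightarrow>
      (\<forall>\<epsilon>>0. \<exists>v. continuous_on {0..T} v \<and>
        C0_norm T v \<le> C * exp (C * (W1inf_norm T w / \<epsilon>) powr (1 / s)) * W1inf_norm T w \<and>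
        (\<exists>y. heat_solution L T v y) \<and>
        (\<forall>y. heat_solution L T v y \<longrightarrow>
          (\<exists>p. dx_trace_left L T y p \<and> C0_norm T (\<lambda>t. p t - w t) \<le> \<epsilon>))))"
proof (intro allI impI)
  fix s :: real assume s: "0 < s \<and> s < 1"
  define Z where "Z = zeta_sum (2 - s)"
  have Z: "Z > 0" unfolding Z_def using zeta_sum_sums(2) s by simp
  define C1 where "C1 = L / (1 - 2 powr - s)"
  \<comment> \<open>What remains of the exponent in \<open>gevrey_heat_coefficients\<close> once 1 /
    \<delta> = W1inf_norm T w / \<epsilon> is taken out of the power 1 / s.\<close>
  define C2 where "C2 = 2 * s * (2 * Z * L\<^sup>2) powr (1 / s)"
  have "2 powr - s < 2 powr (0::real)" using s by (intro powr_less_mono) auto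
  then have C1: "C1 > 0" using assms by (simp add: C1_def)
  have C2: "C2 > 0" using s Z assms by (simp add: C2_def)
  show "\<exists>C>0. \<forall>w. W1inf T w \<and> w 0 = 0 \<longrightarrow>
      (\<forall>\<epsilon>>0. \<exists>v. continuous_on {0..T} v \<and>
        C0_norm T v \<le> C * exp (C * (W1inf_norm T w / \<epsilon>) powr (1 / s)) * W1inf_norm T w \<and>
        (\<exists>y. heat_solution L T v y) \<and>
        (\<forall>y. heat_solution L T v y \<longrightarrow>
          (\<exists>p. dx_trace_left L T y p \<and> C0_norm T (\<lambda>t. p t - w t) \<le> \<epsilon>)))"
  \<comment> \<open>A single constant has to serve both as prefactor and as rate in the exponential,
    hence the sum.\<close>
  proof (rule exI[of _ "C1 + C2"], intro conjI allI impI)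
    show "0 < C1 + C2" using C1 C2 by simp
    fix w and \<epsilon> :: real assume w: "W1inf T w \<and> w 0 = 0" and \<epsilon>: "\<epsilon> > 0"
    define g where "g = weak_deriv T w"
    have cw: "continuous_on {0..T} w" "Linf T w" using w by (auto simp: W1inf_def)
    have "\<exists>g. Linf T g \<and> has_weak_deriv T w g" using w by (simp add: W1inf_def)
    then have "Linf T g \<and> has_weak_deriv T w g"
      \<comment> \<open>\<open>W1inf_norm\<close> is computed from the chosen weak derivative, so
        the Lipschitz bound is derived for this very choice.\<close>
      unfolding g_def weak_deriv_def by (rule someI_ex)
    then have g: "Linf T g" "has_weak_deriv T w g" by auto
    define N where "N = Linf_norm T w"
    define G where "G = Linf_norm T g"
    define M where "M = W1inf_norm T w"
    have NG: "M = N + G" "N \<ge> 0" "G \<ge> 0"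
      using Linf_norm_nonneg cw(2) g(1) assms(2) by (auto simp: M_def N_def G_def W1inf_norm_def g_def)
    have lipw: "G-lipschitz_on {0..T} w"
      unfolding G_def by (rule weak_deriv_lipschitz[OF cw(1) g assms(2)])
    \<comment> \<open>Constant continuation beyond [0, T]: the projection onto [0, T] is
      1-Lipschitz, and w 0 = 0 makes f vanish for t \<le> 0.\<close>
    define f where "f t = w (max 0 (min t T))" for t
    have clamp: "max 0 (min t T) \<in> {0..T}" for t using assms(2) by auto
    have lipf: "G-lipschitz_on UNIV f"
    proof (rule lipschitz_onI[OF _ NG(3)])
      fix x y
      have "dist (f x) (f y) \<le> G * dist (max 0 (min x T)) (max 0 (min y T))"
        unfolding f_def by (rule lipschitz_onD[OF lipw clamp clamp])
      also have "\<dots> \<le> G * dist x y"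
        using NG(3) by (intro mult_left_mono) (auto simp: dist_real_def max_def min_def)
      finally show "dist (f x) (f y) \<le> G * dist x y" .
    qed
    have fM: "\<bar>f t\<bar> \<le> M" for t
      using abs_le_Linf_norm[OF cw assms(2) clamp, of t] NG by (simp add: f_def N_def)
    have f0: "f t = 0" if "t \<le> 0" for t using that w assms(2) by (simp add: f_def)
    have fw: "f t = w t" if "t \<in> {0..T}" for t using that by (simp add: f_def)
    \<comment> \<open>If M = 0 then G = 0 and the control is zero, so any positive scale will do;
      otherwise G * \<delta> \<le> M * \<delta> = \<epsilon>.\<close>
    define \<delta> where "\<delta> = (if M = 0 then 1 else \<epsilon> / M)"
    have \<delta>: "\<delta> > 0" "G * \<delta> \<le> \<epsilon>"
    proof -
      show "\<delta> > 0" using NG \<epsilon> by (auto simp: \<delta>_def)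
      then have "G * \<delta> \<le> M * \<delta>" using NG by (intro mult_right_mono) auto
      also have "\<dots> \<le> \<epsilon>" using \<epsilon> by (simp add: \<delta>_def)
      finally show "G * \<delta> \<le> \<epsilon>" .
    qed
    obtain F B where FB: "heat_coefficients F B" "\<And>k. F k 0 = 0" "\<And>t. \<bar>F 0 t - f t\<bar> \<le> G * \<delta>"
      and bound: "\<And>t. \<bar>heat_series 1 F t L\<bar> \<le> M * (C1 * exp (2 * s * (2 * Z / \<delta> * L\<^sup>2) powr (1 / s)))"
      using gevrey_heat_coefficients[OF _ _ \<delta>(1) assms(1) lipf fM f0, of s] s unfolding C1_def Z_def by blast
    interpret heat_coefficients F B by (rule FB)
    let ?v = "\<lambda>t. heat_series 1 F t L"
    have sol: "heat_solution L T ?v (heat_series 1 F)" by (rule heat_series_solution[OF FB(2)])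
    have cost: "M * (C1 * exp (2 * s * (2 * Z / \<delta> * L\<^sup>2) powr (1 / s)))
        \<le> (C1 + C2) * exp ((C1 + C2) * (M / \<epsilon>) powr (1 / s)) * M"
    proof (cases "M = 0")
      case False
      then have "M > 0" using NG by linarith
      have "2 * Z / \<delta> * L\<^sup>2 = 2 * Z * L\<^sup>2 * (M / \<epsilon>)" using False by (simp add: \<delta>_def)
      then have "2 * s * (2 * Z / \<delta> * L\<^sup>2) powr (1 / s) = C2 * (M / \<epsilon>) powr (1 / s)"
        using Z \<open>M > 0\<close> \<epsilon> by (simp only: powr_mult C2_def mult.assoc)
      also have "\<dots> \<le> (C1 + C2) * (M / \<epsilon>) powr (1 / s)"
        using C1 by (intro mult_right_mono) auto
      finally have "C1 * exp (2 * s * (2 * Z / \<delta> * L\<^sup>2) powr (1 / s))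
          \<le> (C1 + C2) * exp ((C1 + C2) * (M / \<epsilon>) powr (1 / s))"
        using C1 C2 by (intro mult_mono) auto
      then show ?thesis using \<open>M > 0\<close> by (simp add: mult.commute)
    qed simp
    show "\<exists>v. continuous_on {0..T} v \<and>
        C0_norm T v \<le> (C1 + C2) * exp ((C1 + C2) * (W1inf_norm T w / \<epsilon>) powr (1 / s)) * W1inf_norm T w \<and>
        (\<exists>y. heat_solution L T v y) \<and>
        (\<forall>y. heat_solution L T v y \<longrightarrow>
          (\<exists>p. dx_trace_left L T y p \<and> C0_norm T (\<lambda>t. p t - w t) \<le> \<epsilon>))"
      unfolding M_def[symmetric]
    proof (rule exI[of _ ?v], intro conjI allI impI)
      show "continuous_on {0..T} ?v"
        using heat_series_dt by (meson DERIV_isCont continuous_at_imp_continuous_on)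
      show "C0_norm T ?v \<le> (C1 + C2) * exp ((C1 + C2) * (M / \<epsilon>) powr (1 / s)) * M"
        using order_trans[OF bound cost] by (rule C0_norm_le[OF assms(2)])
      show "\<exists>y. heat_solution L T ?v y" using sol by blast
      fix y assume y: "heat_solution L T ?v y"
      have "dx_trace_left L T y (F 0)"
        unfolding dx_trace_left_def
      proof (intro conjI ballI)
        show "continuous_on {0..T} (F 0)" by (rule F_continuous)
        fix t assume t: "t \<in> {0..T}"
        have "(heat_series 1 F t has_real_derivative F 0 t) (at 0 within {0..L})"
          using heat_series_dx_1[of t 0] by (simp add: heat_series_0_at_0 has_field_derivative_at_within)
        \<comment> \<open>By uniqueness y coincides with the series on the closed rectangle, so the
          one-sided derivative at 0 carries over.\<close>
        then show "(y t has_real_derivative F 0 t) (at 0 within {0..L})"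
          by (rule has_field_derivative_transform_within[where d=1])
            (use assms heat_solution_unique[OF sol y assms t] in auto)
      qed
      moreover have "C0_norm T (\<lambda>t. F 0 t - w t) \<le> \<epsilon>"
      proof (rule C0_norm_le[OF assms(2)])
        fix t assume "t \<in> {0..T}"
        then show "\<bar>F 0 t - w t\<bar> \<le> \<epsilon>" using FB(3)[of t] \<delta>(2) fw by simp
      qed
      ultimately show "\<exists>p. dx_trace_left L T y p \<and> C0_norm T (\<lambda>t. p t - w t) \<le> \<epsilon>" by blast
    qed
  qed
qed

end
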